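(* For any $p \in (0,+\infty)$ there exists a domain $\Omega \subseteq \mathbb{C}$ for which $\mathrm{h}(\Omega) = p$.
   Context: A domain is a nonempty open connected subset of $\mathbb{C}$. Let $\mathbb{D}$ be the open unit disc, $\mathbb{T}=\partial\mathbb{D}$, and $m$ the normalized length measure on $\mathbb{T}$. For $0<q<+\infty$, $H^q(\mathbb{D})$ is the set of holomorphic $f:\mathbb{D}\to\mathbb{C}$ with $\sup_{0<r<1}\int_{\mathbb{T}}|f(r\xi)|^q\,dm(\xi)<+\infty$. The Hardy number of a holomorphic $f:\mathbb{D}\to\mathbb{C}$ is $\mathrm{h}(f)=\sup(\{0\}\cup\{q>0: f\in H^q(\mathbb{D})\})\in[0,+\infty]$. The Hardy number of a domain $\Omega$ is $\mathrm{h}(\Omega)=\inf\{\mathrm{h}(f): f:\mathbb{D}\to\mathbb{C} \text{ holomorphic},\ f(\mathbb{D})\subseteq\Omega\}$. *)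

theory Defs
  imports "HOL-Complex_Analysis.Complex_Analysis"
begin

definition is_domain :: "complex set \<Rightarrow> bool" where
  "is_domain \<Omega> \<longleftrightarrow> \<Omega> \<noteq> {} \<and> open \<Omega> \<and> connected \<Omega>"

abbreviation unit_disc :: "complex set" where
  "unit_disc \<equiv> ball 0 1"

abbreviation unit_circle :: "complex set" where
  "unit_circle \<equiv> sphere 0 1"

text \<open>Normalized length measure on the unit circle: the image of the uniform
  probability measure on an interval of length \<open>2 * pi\<close> under the arc-length
  parametrization \<open>t \<mapsto> exp (i t)\<close>.\<close>

definition circle_measure :: "complex measure" where
  "circle_measure =
     distr (uniform_measure lborel {0..2 * pi}) (restrict_space borel unit_circle) cis"

text \<open>A function on the unit disc is represented by a total function on the complex
  plane; its values outside the disc play no role. The integrals are taken in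
  \<open>[0, \<infinity>]\<close>, so that the finiteness of the supremum is meaningful as it stands.\<close>

definition hardy_space :: "real \<Rightarrow> (complex \<Rightarrow> complex) set" where
  "hardy_space q =
     {f. f holomorphic_on unit_disc \<and>
         (SUP r\<in>{0<..<1::real}.
            \<integral>\<^sup>+ \<xi>. ennreal (cmod (f (of_real r * \<xi>)) powr q) \<partial>circle_measure) < \<infinity>}"

definition hardy_number :: "(complex \<Rightarrow> complex) \<Rightarrow> ereal" where
  "hardy_number f = Sup ({0} \<union> {ereal q | q. q > 0 \<and> f \<in> hardy_space q})"

definition domain_hardy_number :: "complex set \<Rightarrow> ereal" where
  "domain_hardy_number \<Omega> =
     Inf {hardy_number f | f. f holomorphic_on unit_disc \<and> f ` unit_disc \<subseteq> \<Omega>}"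

end

theory Submission
  imports Defs "HOL-Real_Asymp.Real_Asymp"
begin

text \<open>The Hardy number of a sector of opening \<open>pi / a\<close> is \<open>a\<close>, but sectors only give values \<open>a \<ge> 1/2\<close>, and
the same holds for all simply connected domains other than the plane. Smaller values require multiply
connected domains. Here a single construction serves all \<open>p > 0\<close>. Cut the logarithmic scale
\<open>ln (cmod w)\<close> into blocks and gaps, where the \<open>n\<close>-th block and the gap after it fill the interval from
\<open>n^2\<close> to \<open>(n + 1)^2\<close>. On the blocks the domain is the sector of opening \<open>pi / (p + 1)\<close>; on the
gaps it contains the whole annulus. A gap contributes to growth only a factor that is at most polynomial in its
logarithmic length, hence the exponent 0 in the limit, and a block contributes the exponent
\<open>p + 1\<close>. Since the blocks take the proportion \<open>p / (p + 1)\<close> of the scale, the average exponent is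
\<open>p\<close>. Lengths that tend to infinity absorb all constants lost at the transitions.

\<^bold>\<open>Every map into the domain is good enough.\<close> For \<open>q < p\<close> a superharmonic majorant of
\<open>cmod w powr q\<close> is constant on each gap, and on each block it is the minimum of constants and an explicit
harmonic function (\<open>sector_factor\<close>, \<open>superharmonic_majorant_exp_comb\<close>). Composed with any
holomorphic map from the disc into the domain it stays superharmonic, and the mean value inequality
(\<open>circle_mean_le_center\<close>) bounds the circle means
(\<open>hardy_space_superharmonic_majorant\<close>).

\<^bold>\<open>Some map is not better.\<close> The domain is defined as the image under \<open>exp\<close> of a comb-like region
in logarithmic coordinates, which is simply connected because the gaps there are full vertical
strips. The test map is \<open>exp \<circ> g\<close> with \<open>g\<close> a Riemann map onto the comb. The
Schwarz--Pick lemma, applied to a strip and to discs inside the comb, bounds the hyperbolic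
distance from \<open>0\<close> to \<open>n^2\<close> by about \<open>p * n^2\<close> (\<open>bdry_ratio_comb_step\<close>). Up to lower order terms,
\<open>exp \<circ> g\<close> therefore grows at
least like the power \<open>1 / p\<close> of the inverse distance to the circle, too fast for any
exponent \<open>q > p\<close> (\<open>exp_comb_map_not_in_hardy_space\<close>).\<close>

section \<open>Integrals over the unit circle\<close>

lemma nn_integral_circle_measure:
  assumes cont: "continuous_on (sphere 0 1) g" and nonneg: "\<And>\<xi>. \<xi> \<in> sphere 0 1 \<Longrightarrow> 0 \<le> g \<xi>"
  shows "(\<integral>\<^sup>+ \<xi>. ennreal (g \<xi>) \<partial>circle_measure)
           = ennreal (integral {0..2 * pi} (\<lambda>t. g (cis t)) / (2 * pi))"
proof -
  have gm: "(\<lambda>\<xi>. ennreal (g \<xi>)) \<in> borel_measurable (restrict_space borel (sphere 0 1))"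
    using borel_measurable_continuous_on_restrict[OF cont] by measurable
  have cm: "cis \<in> uniform_measure lborel {0..2 * pi} \<rightarrow>\<^sub>M restrict_space borel (sphere 0 1)"
  proof (rule measurable_restrict_space2)
    show "cis \<in> space (uniform_measure lborel {0..2 * pi}) \<rightarrow> sphere 0 1" by auto
    have "continuous_on UNIV cis" by (intro continuous_intros)
    then have "cis \<in> borel \<rightarrow>\<^sub>M borel" by (rule borel_measurable_continuous_onI)
    moreover have "sets (uniform_measure lborel {0..2 * pi}) = sets (borel :: real measure)" by simp
    ultimately show "cis \<in> uniform_measure lborel {0..2 * pi} \<rightarrow>\<^sub>M borel"
      using measurable_cong_sets[OF _ refl] by blast
  qed
  have contc: "continuous_on {0..2*pi} (\<lambda>t. g (cis t))"
    by (rule continuous_on_compose2[OF cont]) (auto intro!: continuous_intros)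
  then have int: "(\<lambda>t. g (cis t)) integrable_on {0..2*pi}"
    by (rule integrable_continuous_real)
  have gb: "(\<lambda>t. ennreal (g (cis t))) \<in> borel_measurable borel"
  proof -
    have "continuous_on UNIV (\<lambda>t. g (cis t))"
      by (rule continuous_on_compose2[OF cont]) (auto intro!: continuous_intros)
    then show ?thesis by (auto dest: borel_measurable_continuous_onI)
  qed
  have "(\<integral>\<^sup>+ \<xi>. ennreal (g \<xi>) \<partial>circle_measure)
      = (\<integral>\<^sup>+ t. ennreal (g (cis t)) \<partial>uniform_measure lborel {0..2 * pi})"
    unfolding circle_measure_def by (rule nn_integral_distr[OF cm]) (use gm in simp)
  also have "\<dots> = (\<integral>\<^sup>+ t. ennreal (g (cis t)) * indicator {0..2*pi} t \<partial>lborel) / emeasure lborel {0..2*pi}"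
    using gb by (subst nn_integral_uniform_measure) auto
  also have "(\<integral>\<^sup>+ t. ennreal (g (cis t)) * indicator {0..2*pi} t \<partial>lborel)
      = ennreal (integral {0..2*pi} (\<lambda>t. g (cis t)))"
  proof -
    have "((\<lambda>t. g (cis t)) has_integral (integral {0..2*pi} (\<lambda>t. g (cis t)))) {0..2*pi}"
      using int by (simp add: has_integral_integral)
    then have hi: "((\<lambda>t. if t \<in> {0..2*pi} then g (cis t) else 0) has_integral
                (integral {0..2*pi} (\<lambda>t. g (cis t)))) UNIV"
      by (simp only: has_integral_restrict_UNIV)
    have "(\<integral>\<^sup>+ t. ennreal (if t \<in> {0..2*pi} then g (cis t) else 0) \<partial>lborel)
        = ennreal (integral {0..2*pi} (\<lambda>t. g (cis t)))"
    proof (rule nn_integral_has_integral_lborel[OF _ _ hi])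
      have "(\<lambda>t. g (cis t)) \<in> borel_measurable borel"
        by (intro borel_measurable_continuous_onI continuous_on_compose2[OF cont])
           (auto intro!: continuous_intros)
      then show "(\<lambda>t. if t \<in> {0..2*pi} then g (cis t) else 0) \<in> borel_measurable borel"
        by (intro measurable_If) auto
    qed (use nonneg in auto)
    then show ?thesis
      by (smt (verit, ccfv_SIG) ennreal_0 indicator_simps mult.right_neutral mult_zero_right nn_integral_cong)
  qed
  also have "emeasure lborel {0..2*pi} = ennreal (2*pi)" by simp
  also have "ennreal (integral {0..2*pi} (\<lambda>t. g (cis t))) / ennreal (2*pi)
      = ennreal (integral {0..2*pi} (\<lambda>t. g (cis t)) / (2*pi))"
    by (intro divide_ennreal integral_nonneg[OF int]) (use nonneg in auto)
  finally show ?thesis .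
qed

lemma Cauchy_formula_circle:
  fixes F :: "complex \<Rightarrow> complex"
  assumes contF: "continuous_on (cball 0 1) F" and holF: "F holomorphic_on ball 0 1"
    and z: "norm z < 1"
  shows "((\<lambda>t. F (cis t) * cis t / (cis t - z)) has_integral (2 * pi * F z)) {0..2 * pi}"
proof -
  have "((\<lambda>u. F u/(u-z)) has_contour_integral (2 * of_real pi * \<i> * F z)) (circlepath 0 1)"
    by (rule Cauchy_integral_circlepath[OF contF holF]) (use z in simp)
  then have "((\<lambda>t. F (cis t) / (cis t - z) * \<i> * cis t) has_integral (2 * of_real pi * \<i> * F z)) {0..2 * pi}"
    by (simp add: circlepath_def has_contour_integral_part_circlepath_iff)
  from has_integral_mult_right[OF this, of "- \<i>"]
  show ?thesis by (simp add: mult_ac)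
qed

text \<open>The Cauchy kernel is bounded by the inverse distance of \<open>z\<close> to the circle. The bound is what forces
functions of a Hardy space to grow at most like a power of that inverse distance.\<close>

lemma norm_le_circle_mean:
  fixes F :: "complex \<Rightarrow> complex"
  assumes contF: "continuous_on (cball 0 1) F" and holF: "F holomorphic_on ball 0 1"
    and z: "norm z < 1"
  shows "norm (F z) * (1 - norm z) \<le> integral {0..2 * pi} (\<lambda>t. norm (F (cis t))) / (2 * pi)"
proof -
  have c: "continuous_on {0..2*pi} (\<lambda>t. F (cis t))"
    by (rule continuous_on_compose2[OF contF]) (auto intro!: continuous_intros)
  note I = Cauchy_formula_circle[OF assms]
  have "norm (2 * pi * F z) \<le> integral {0..2 * pi} (\<lambda>t. norm (F (cis t)) / (1 - norm z))"
    unfolding integral_unique[OF I, symmetric]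
  proof (rule integral_norm_bound_integral)
    show "(\<lambda>t. F (cis t) * cis t / (cis t - z)) integrable_on {0..2 * pi}" using I by blast
    show "(\<lambda>t. norm (F (cis t)) / (1 - norm z)) integrable_on {0..2 * pi}"
      using c z by (intro integrable_continuous_real continuous_intros) auto
    fix t
    have "1 - norm z \<le> norm (cis t - z)"
      by (metis norm_cis norm_triangle_ineq2)
    then show "norm (F (cis t) * cis t / (cis t - z)) \<le> norm (F (cis t)) / (1 - norm z)"
      using z by (simp add: norm_divide norm_mult frac_le)
  qed
  then show ?thesis using z
    by (simp add: norm_mult field_simps)
qed

lemma circle_mean_Re:
  fixes F :: "complex \<Rightarrow> complex"
  assumes contF: "continuous_on (cball 0 1) F" and holF: "F holomorphic_on ball 0 1"
  shows "((\<lambda>t. Re (F (cis t))) has_integral 2 * pi * Re (F 0)) {0..2 * pi}"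
  using has_integral_Re[OF Cauchy_formula_circle[OF assms, of 0]] by simp

text \<open>On the circle \<open>cnj z = 1 / z\<close>, so a product of two monomial real parts splits into the real parts of a
monomial of degree \<open>i + j\<close> and of one of degree \<open>i - j\<close>; if the latter degree is negative,
conjugation makes it positive. Hence the boundary values of harmonic polynomials are closed under
multiplication.\<close>

lemma Re_monom_mult_on_circle:
  fixes a b :: complex and i j :: nat
  shows "\<exists>P :: complex poly. \<forall>z\<in>sphere 0 1. Re (a * z ^ i) * Re (b * z ^ j) = Re (poly P z)"
proof -
  have *: "\<exists>P :: complex poly. \<forall>z\<in>sphere 0 1. Re (a * z ^ (j + k)) * Re (b * z ^ j) = Re (poly P z)"
    for a b :: complex and j k :: nat
  proof (intro exI ballI)
    fix z :: complex assume "z \<in> sphere 0 1"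
    then have z: "z ^ j * cnj (z ^ j) = 1"
      by (simp add: complex_norm_square[symmetric] norm_power del: complex_cnj_power)
    have Re_mult: "Re (u * v + u * cnj v) / 2 = Re u * Re v" for u v :: complex
      by simp
    have "Re (poly (monom (a * b / 2) (j + k + j) + monom (a * cnj b / 2) k) z)
       = Re ((a * z ^ (j + k)) * (b * z ^ j) + a * cnj b * z ^ k * (z ^ j * cnj (z ^ j))) / 2"
      unfolding z by (simp add: poly_monom power_add field_simps)
    also have "\<dots> = Re ((a * z ^ (j + k)) * (b * z ^ j) + (a * z ^ (j + k)) * cnj (b * z ^ j)) / 2"
      by (simp add: power_add algebra_simps)
    also have "\<dots> = Re (a * z ^ (j + k)) * Re (b * z ^ j)" 
      by (rule Re_mult)
    finally show "Re (a * z ^ (j + k)) * Re (b * z ^ j)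
       = Re (poly (monom (a * b / 2) (j + k + j) + monom (a * cnj b / 2) k) z)" ..
  qed
  show ?thesis
  proof (cases "j \<le> i")
    case True
    then show ?thesis using *[of a j "i - j" b] by simp
  next
    case False
    then show ?thesis using *[of b i "j - i" a] by (simp add: mult.commute)
  qed
qed

lemma real_polynomial_function_on_circle:
  fixes h :: "complex \<Rightarrow> real"
  assumes "real_polynomial_function h"
  shows "\<exists>P. \<forall>z\<in>sphere 0 1. h z = Re (poly P z)"
  using assms
proof (induction rule: real_polynomial_function.induct)
  case (linear f)
  interpret bounded_linear f by fact
  have "f z = Re (poly [:0, Complex (f 1) (- f \<i>):] z)" for z
  proof -
    have "f z = f (Re z *\<^sub>R 1 + Im z *\<^sub>R \<i>)" 
      by (metis complex_eq mult.commute scaleR_conv_of_real mult.right_neutral)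
    then show ?thesis by (simp add: add scaleR)
  qed
  then show ?case by blast
next
  case (const c)
  show ?case by (intro exI[of _ "[:of_real c:]"]) simp
next
  case (add f g)
  then obtain P Q where "\<forall>z\<in>sphere 0 1. f z = Re (poly P z)" "\<forall>z\<in>sphere 0 1. g z = Re (poly Q z)" by blast
  then show ?case by (intro exI[of _ "P + Q"]) simp
next
  case (mult f g)
  then obtain P Q where P: "\<forall>z\<in>sphere 0 1. f z = Re (poly P z)"
    and Q: "\<forall>z\<in>sphere 0 1. g z = Re (poly Q z)" by blast
  obtain R where R: "\<And>i j z. z \<in> sphere 0 1 \<Longrightarrow>
      Re (coeff P i * z ^ i) * Re (coeff Q j * z ^ j) = Re (poly (R i j) z)"
  proof -
    have "\<forall>i j. \<exists>R. \<forall>z\<in>sphere 0 1. Re (coeff P i * z ^ i) * Re (coeff Q j * z ^ j) = Re (poly R z)"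
      using Re_monom_mult_on_circle by blast
    then show ?thesis using that by metis
  qed
  show ?case
  proof (intro exI ballI)
    fix z :: complex assume z: "z \<in> sphere 0 1"
    have "f z * g z = (\<Sum>i\<le>degree P. \<Sum>j\<le>degree Q. Re (coeff P i * z ^ i) * Re (coeff Q j * z ^ j))"
      using P Q z by (simp add: poly_altdef sum_product del: times_complex.sel)
    also have "\<dots> = Re (poly (\<Sum>i\<le>degree P. \<Sum>j\<le>degree Q. R i j) z)"
      using R[OF z] by (simp add: poly_sum del: times_complex.sel)
    finally show "f z * g z = Re (poly (\<Sum>i\<le>degree P. \<Sum>j\<le>degree Q. R i j) z)" .
  qed
qed

text \<open>The Weierstrass theorem in this form replaces the solution of the Dirichlet problem by a Poisson
integral: up to \<open>\<epsilon>\<close>, continuous boundary values are those of an explicit harmonic function.\<close>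

lemma approx_by_Re_poly_on_circle:
  fixes h :: "complex \<Rightarrow> real"
  assumes "continuous_on (sphere 0 1) h" "0 < \<epsilon>"
  obtains P where "\<And>z. z \<in> sphere 0 1 \<Longrightarrow> \<bar>h z - Re (poly P z)\<bar> < \<epsilon>"
proof -
  obtain g where g: "real_polynomial_function g" "\<And>z. z \<in> sphere 0 1 \<Longrightarrow> \<bar>h z - g z\<bar> < \<epsilon>"
    using Stone_Weierstrass_real_polynomial_function[OF compact_sphere assms] by blast
  then show ?thesis using real_polynomial_function_on_circle[OF g(1)] that by metis
qed

section \<open>Superharmonic functions through harmonic support functions\<close>

text \<open>A local form of superharmonicity: near \<open>w\<close> the function lies below a harmonic function that touches it
at \<open>w\<close>. Minima of harmonic functions have this property, and it is inherited by compositions with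
holomorphic maps, which is all that is needed of superharmonic functions below.\<close>

definition harmonic_above :: "(complex \<Rightarrow> real) \<Rightarrow> complex \<Rightarrow> bool" where
  "harmonic_above u w \<longleftrightarrow>
     (\<exists>e>0. \<exists>\<phi>. \<phi> holomorphic_on ball w e \<and> u w = Re (\<phi> w) \<and> (\<forall>z\<in>ball w e. u z \<le> Re (\<phi> z)))"

lemma harmonic_aboveI:
  assumes "open T" "w \<in> T" "\<phi> holomorphic_on T" "u w = Re (\<phi> w)" "\<And>z. z \<in> T \<Longrightarrow> u z \<le> Re (\<phi> z)"
  shows "harmonic_above u w"
proof -
  obtain e where "e > 0" "ball w e \<subseteq> T" using assms(1,2) open_contains_ball by blast
  then show ?thesis unfolding harmonic_above_def using assms by (meson holomorphic_on_subset subsetD)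
qed

lemma harmonic_above_cong:
  assumes "harmonic_above u w" "open T" "w \<in> T" "\<And>z. z \<in> T \<Longrightarrow> u' z = c * u z" "0 \<le> c"
  shows "harmonic_above u' w"
proof -
  obtain e \<phi> where e: "e > 0" and \<phi>: "\<phi> holomorphic_on ball w e" "u w = Re (\<phi> w)"
    "\<And>z. z \<in> ball w e \<Longrightarrow> u z \<le> Re (\<phi> z)"
    using assms(1) unfolding harmonic_above_def by blast
  show ?thesis
  proof (rule harmonic_aboveI[where T = "ball w e \<inter> T" and \<phi> = "\<lambda>z. of_real c * \<phi> z"])
    show "(\<lambda>z. of_real c * \<phi> z) holomorphic_on ball w e \<inter> T"
      using \<phi>(1) by (intro holomorphic_intros) (auto elim: holomorphic_on_subset)
    show "u' z \<le> Re (of_real c * \<phi> z)" if "z \<in> ball w e \<inter> T" for z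
      using that \<phi>(3)[of z] assms(4)[of z] assms(5) by (simp add: mult_left_mono)
  qed (use assms e \<phi> in auto)
qed

lemma harmonic_above_compose:
  assumes "harmonic_above u (f z)" "f holomorphic_on T" "open T" "z \<in> T"
  shows "harmonic_above (\<lambda>z. u (f z)) z"
proof -
  obtain e \<phi> where e: "e > 0" and \<phi>: "\<phi> holomorphic_on ball (f z) e" "u (f z) = Re (\<phi> (f z))"
    "\<And>w. w \<in> ball (f z) e \<Longrightarrow> u w \<le> Re (\<phi> w)"
    using assms(1) unfolding harmonic_above_def by blast
  have "open (f -` ball (f z) e \<inter> T)"
    using assms(2,3) by (metis continuous_on_open_vimage holomorphic_on_imp_continuous_on open_ball)
  then show ?thesis
  proof (rule harmonic_aboveI[where \<phi> = "\<phi> \<circ> f"])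
    show "\<phi> \<circ> f holomorphic_on f -` ball (f z) e \<inter> T"
      by (rule holomorphic_on_compose_gen[OF _ \<phi>(1)]) (auto intro: holomorphic_on_subset[OF assms(2)])
  qed (use e \<phi> assms(4) in auto)
qed

lemma harmonic_above_diff_Re:
  assumes "harmonic_above u z" "F holomorphic_on T" "open T" "z \<in> T"
  shows "harmonic_above (\<lambda>z. u z - Re (F z)) z"
proof -
  obtain e \<phi> where e: "e > 0" and \<phi>: "\<phi> holomorphic_on ball z e" "u z = Re (\<phi> z)"
    "\<And>w. w \<in> ball z e \<Longrightarrow> u w \<le> Re (\<phi> w)"
    using assms(1) unfolding harmonic_above_def by blast
  show ?thesis
    by (rule harmonic_aboveI[where T = "ball z e \<inter> T" and \<phi> = "\<lambda>z. \<phi> z - F z"])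
       (use e \<phi> assms in \<open>auto intro!: holomorphic_intros intro: holomorphic_on_subset\<close>)
qed

text \<open>At a local minimum of \<open>u\<close> the touching harmonic function \<open>Re \<circ> \<phi>\<close> has a local minimum as
well, hence is constant (the maximum principle for \<open>exp (- \<phi>)\<close>), and \<open>u\<close> is squeezed
between this constant and its own minimum.\<close>

lemma harmonic_above_local_min:
  assumes "harmonic_above u w" "0 < d" and min: "\<And>z. z \<in> ball w d \<Longrightarrow> u w \<le> u z"
  obtains e where "0 < e" "\<And>z. z \<in> ball w e \<Longrightarrow> u z = u w"
proof -
  obtain e0 \<phi> where e0: "e0 > 0" and \<phi>0: "\<phi> holomorphic_on ball w e0" "u w = Re (\<phi> w)"
    "\<And>z. z \<in> ball w e0 \<Longrightarrow> u z \<le> Re (\<phi> z)"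
    using assms(1) unfolding harmonic_above_def by blast
  define e where "e = min e0 d"
  have e: "e > 0" "ball w e \<subseteq> ball w e0" "ball w e \<subseteq> ball w d" using e0 assms(2) by (auto simp: e_def)
  have "(\<lambda>z. exp (- \<phi> z)) constant_on ball w e"
  proof (rule maximum_modulus_principle[where U = "ball w e" and \<xi> = w])
    show "(\<lambda>z. exp (- \<phi> z)) holomorphic_on ball w e"
      using holomorphic_on_subset[OF \<phi>0(1) e(2)] by (intro holomorphic_intros)
    show "cmod (exp (- \<phi> z)) \<le> cmod (exp (- \<phi> w))" if "z \<in> ball w e" for z
      using min[of z] \<phi>0(2) \<phi>0(3)[of z] that e by force
  qed (use e in auto)
  then have const: "exp (- \<phi> z) = exp (- \<phi> w)" if "z \<in> ball w e" for z
    using that e(1) unfolding constant_on_def by (metis centre_in_ball)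
  have "u z = u w" if z: "z \<in> ball w e" for z
  proof -
    have "exp (- Re (\<phi> z)) = exp (- Re (\<phi> w))"
      using arg_cong[OF const[OF z], of norm] by simp
    then have "Re (\<phi> z) = Re (\<phi> w)" by simp
    then show ?thesis using min[of z] \<phi>0(2) \<phi>0(3)[of z] e z by force
  qed
  then show ?thesis using that e(1) by blast
qed

text \<open>If the minimum were smaller than \<open>m\<close>, the points where it is attained would form a compact set in the
open disc, and near a point of that set of largest modulus the function would be constant,
which produces minimum points of larger modulus.\<close>

lemma minimum_principle:
  assumes cont: "continuous_on (cball 0 1) u"
    and above: "\<And>z. z \<in> ball 0 1 \<Longrightarrow> harmonic_above u z"
    and bdry: "\<And>z. z \<in> sphere 0 1 \<Longrightarrow> m \<le> u z"
    and z: "z \<in> cball 0 1"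
  shows "m \<le> u z"
proof (rule ccontr)
  assume "\<not> m \<le> u z"
  obtain a where a: "a \<in> cball 0 1" and amin: "\<And>y. y \<in> cball 0 1 \<Longrightarrow> u a \<le> u y"
    using continuous_attains_inf[OF compact_cball _ cont] by auto
  have ua: "u a < m" using amin[OF z] \<open>\<not> m \<le> u z\<close> by simp
  define K where "K = cball 0 1 \<inter> u -` {..u a}"
  have "closed K" unfolding K_def by (intro continuous_closed_preimage[OF cont]) auto
  then have "compact K" unfolding K_def by (metis bounded_Int bounded_cball compact_eq_bounded_closed)
  moreover have "a \<in> K" using a by (simp add: K_def)
  ultimately obtain b where b: "b \<in> K" and bmax: "\<And>y. y \<in> K \<Longrightarrow> norm y \<le> norm b"
    using continuous_attains_sup[of K norm] continuous_on_norm_id by (metis empty_iff)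
  have ub: "u b = u a" using b amin[of b] by (simp add: K_def)
  have bb: "b \<in> ball 0 1"
  proof (rule ccontr)
    assume "b \<notin> ball 0 1"
    then have "b \<in> sphere 0 1" using b by (simp add: K_def)
    then show False using bdry[of b] ub ua by simp
  qed
  obtain d where d: "d > 0" "ball b d \<subseteq> ball 0 1" using bb by (metis open_ball open_contains_ball)
  obtain e where e: "e > 0" and eq: "\<And>y. y \<in> ball b e \<Longrightarrow> u y = u b"
  proof (rule harmonic_above_local_min[OF above[OF bb] d(1)])
    show "u b \<le> u y" if "y \<in> ball b d" for y
      using that d(2) amin[of y] ub by auto
  qed blast
  \<comment> \<open>Moving outwards from \<open>b\<close> by \<open>k\<close> stays in the neighbourhood where \<open>u\<close> is constant.\<close>
  define k where "k = min d e / 2"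
  have k: "0 < k" "k < d" "k < e" using d e by (auto simp: k_def)
  define w where "w = (if b = 0 then of_real k else b + of_real (k / norm b) * b)"
  have nw: "norm w > norm b" and dw: "dist b w = k"
  proof -
    have "norm (b + of_real (k / norm b) * b) = norm b + k" if "b \<noteq> 0"
    proof -
      have "b + of_real (k / norm b) * b = of_real (1 + k / norm b) * b" by (simp add: algebra_simps)
      then have "norm (b + of_real (k / norm b) * b) = \<bar>1 + k / norm b\<bar> * norm b"
        by (metis norm_mult norm_of_real)
      also have "\<dots> = norm b + k" using k that by (simp add: field_simps add_pos_pos)
      finally show ?thesis .
    qed
    then show "norm w > norm b" "dist b w = k" using k by (auto simp: w_def dist_norm norm_mult norm_divide)
  qed
  have "w \<in> ball b d" "w \<in> ball b e" using dw k by auto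
  then have "w \<in> K" using eq[of w] ub d(2) by (auto simp: K_def)
  then show False using bmax[of w] nw by simp
qed

text \<open>The global mean value inequality follows from the local property: compare \<open>v\<close> with a harmonic
polynomial that approximates \<open>h\<close> on the circle, and use the mean value property of the latter.\<close>

lemma circle_mean_le_center:
  assumes contv: "continuous_on (cball 0 1) v"
    and above: "\<And>z. z \<in> ball 0 1 \<Longrightarrow> harmonic_above v z"
    and conth: "continuous_on (sphere 0 1) h"
    and le: "\<And>z. z \<in> sphere 0 1 \<Longrightarrow> h z \<le> v z"
  shows "integral {0..2 * pi} (\<lambda>t. h (cis t)) \<le> 2 * pi * v 0"
proof (rule field_le_epsilon)
  fix d :: real assume "0 < d"
  define \<epsilon> where "\<epsilon> = d / (4 * pi)"
  have \<epsilon>: "\<epsilon> > 0" using \<open>0 < d\<close> by (simp add: \<epsilon>_def)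
  obtain P where P: "\<And>z. z \<in> sphere 0 1 \<Longrightarrow> \<bar>h z - Re (poly P z)\<bar> < \<epsilon>"
    using approx_by_Re_poly_on_circle[OF conth \<epsilon>] by blast
  have "- \<epsilon> \<le> v 0 - Re (poly P 0)"
  proof (rule minimum_principle[where u = "\<lambda>z. v z - Re (poly P z)"])
    show "continuous_on (cball 0 1) (\<lambda>z. v z - Re (poly P z))"
      using contv by (intro continuous_intros)
    show "harmonic_above (\<lambda>z. v z - Re (poly P z)) z" if "z \<in> ball 0 1" for z
      by (rule harmonic_above_diff_Re[OF above[OF that], of _ UNIV]) (auto intro!: holomorphic_intros)
    show "- \<epsilon> \<le> v z - Re (poly P z)" if "z \<in> sphere 0 1" for z
      using P[OF that] le[OF that] by linarith
  qed simp
  have "((\<lambda>t. Re (poly P (cis t)) + \<epsilon>) has_integral 2 * pi * Re (poly P 0) + 2 * pi * \<epsilon>) {0..2 * pi}"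
    using has_integral_const_real[of \<epsilon> 0 "2 * pi"]
    by (intro has_integral_add circle_mean_Re continuous_intros holomorphic_intros) (simp_all)
  moreover have "(\<lambda>t. h (cis t)) integrable_on {0..2 * pi}"
    by (intro integrable_continuous_real continuous_on_compose2[OF conth]) (auto intro!: continuous_intros)
  ultimately have "integral {0..2 * pi} (\<lambda>t. h (cis t)) \<le> 2 * pi * Re (poly P 0) + 2 * pi * \<epsilon>"
  proof (intro has_integral_le[OF integrable_integral])
    show "h (cis t) \<le> Re (poly P (cis t)) + \<epsilon>" for t using P[of "cis t"] by simp
  qed auto
  also have "\<dots> \<le> 2 * pi * (v 0 + \<epsilon>) + 2 * pi * \<epsilon>"
    using \<open>- \<epsilon> \<le> v 0 - Re (poly P 0)\<close> by (intro add_right_mono mult_left_mono) auto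
  also have "\<dots> = 2 * pi * v 0 + d" by (simp add: \<epsilon>_def field_simps)
  finally show "integral {0..2 * pi} (\<lambda>t. h (cis t)) \<le> 2 * pi * v 0 + d" .
qed

section \<open>Two tests for membership in Hardy spaces\<close>

lemma of_real_mult_in_ball:
  assumes "0 < r" "r < 1" "z \<in> cball 0 1"
  shows "of_real r * z \<in> ball (0::complex) 1"
proof -
  have "r * norm z \<le> r * 1" using assms by (intro mult_left_mono) auto
  then have "r * norm z < 1" using assms by linarith
  then show ?thesis using assms by (simp add: norm_mult)
qed

lemma nn_integral_hardy:
  assumes holf: "f holomorphic_on ball 0 1" and "0 < q" and r: "0 < r" "r < 1"
  shows "(\<integral>\<^sup>+ \<xi>. ennreal (cmod (f (of_real r * \<xi>)) powr q) \<partial>circle_measure)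
       = ennreal (integral {0..2 * pi} (\<lambda>t. cmod (f (of_real r * cis t)) powr q) / (2 * pi))"
    and "continuous_on (sphere 0 1) (\<lambda>\<xi>. cmod (f (of_real r * \<xi>)) powr q)"
proof -
  have "norm (of_real r * \<xi>) < 1" if "\<xi> \<in> sphere 0 1" for \<xi> :: complex
    using that r by (simp add: norm_mult)
  then show cont: "continuous_on (sphere 0 1) (\<lambda>\<xi>. cmod (f (of_real r * \<xi>)) powr q)"
    using \<open>0 < q\<close> by (intro continuous_on_powr' continuous_intros
        continuous_on_compose2[OF holomorphic_on_imp_continuous_on[OF holf]]) auto
  show "(\<integral>\<^sup>+ \<xi>. ennreal (cmod (f (of_real r * \<xi>)) powr q) \<partial>circle_measure)
       = ennreal (integral {0..2 * pi} (\<lambda>t. cmod (f (of_real r * cis t)) powr q) / (2 * pi))"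
    by (rule nn_integral_circle_measure[OF cont]) simp
qed

text \<open>A superharmonic majorant of \<open>cmod w powr q\<close> on the target domain bounds all circle means of
\<open>cmod (f z) powr q\<close> by its value at \<open>f 0\<close>.\<close>

lemma hardy_space_superharmonic_majorant:
  assumes holf: "f holomorphic_on ball 0 1" and "0 < q"
    and im: "f ` ball 0 1 \<subseteq> \<Omega>"
    and contU: "continuous_on \<Omega> U"
    and above: "\<And>w. w \<in> \<Omega> \<Longrightarrow> harmonic_above U w"
    and major: "\<And>w. w \<in> \<Omega> \<Longrightarrow> cmod w powr q \<le> U w"
  shows "f \<in> hardy_space q"
proof -
  have "(\<integral>\<^sup>+ \<xi>. ennreal (cmod (f (of_real r * \<xi>)) powr q) \<partial>circle_measure) \<le> ennreal (U (f 0))"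
    if r: "0 < r" "r < 1" for r
  proof -
    note sub = of_real_mult_in_ball[OF r]
    have contf: "continuous_on (ball 0 1) f" using holf by (rule holomorphic_on_imp_continuous_on)
    have "integral {0..2 * pi} (\<lambda>t. cmod (f (of_real r * cis t)) powr q) \<le> 2 * pi * U (f (of_real r * 0))"
    proof (rule circle_mean_le_center[where v = "\<lambda>z. U (f (of_real r * z))"])
      show "continuous_on (cball 0 1) (\<lambda>z. U (f (of_real r * z)))"
        using sub im by (intro continuous_on_compose2[OF contU] continuous_on_compose2[OF contf] continuous_intros) auto
      show "continuous_on (sphere 0 1) (\<lambda>z. cmod (f (of_real r * z)) powr q)"
        by (rule nn_integral_hardy(2)[OF holf \<open>0 < q\<close> r])
      show "cmod (f (of_real r * z)) powr q \<le> U (f (of_real r * z))" if "z \<in> sphere 0 1" for z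
        using that sub[of z] im by (intro major) auto
      show "harmonic_above (\<lambda>z. U (f (of_real r * z))) z" if "z \<in> ball 0 1" for z
      proof (rule harmonic_above_compose[where T = "ball 0 1"])
        show "harmonic_above U (f (of_real r * z))" using that sub[of z] im by (intro above) auto
        have "f \<circ> (\<lambda>z. of_real r * z) holomorphic_on ball 0 1"
          using sub by (intro holomorphic_on_compose_gen[OF _ holf] holomorphic_intros) auto
        then show "(\<lambda>z. f (of_real r * z)) holomorphic_on ball 0 1" by (simp add: o_def)
      qed (use that in auto)
    qed
    then show ?thesis unfolding nn_integral_hardy(1)[OF holf \<open>0 < q\<close> r]
      by (intro ennreal_leI) (simp add: field_simps)
  qed
  then have "(SUP r\<in>{0<..<1}. \<integral>\<^sup>+ \<xi>. ennreal (cmod (f (of_real r * \<xi>)) powr q) \<partial>circle_measure)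
      \<le> ennreal (U (f 0))" by (intro SUP_least) auto
  also have "\<dots> < \<infinity>" by simp
  finally show ?thesis using holf by (simp add: hardy_space_def)
qed

text \<open>The necessary condition for membership is a pointwise one. For a function without zeros, written as an
exponential, the power \<open>q\<close> of its modulus is the modulus of the holomorphic function
\<open>exp (q * g)\<close>, to which the Cauchy bound applies directly.\<close>

lemma hardy_space_growth:
  assumes holg: "g holomorphic_on ball 0 1" and "0 < q" and mem: "(\<lambda>z. exp (g z)) \<in> hardy_space q"
  obtains C where "\<And>z. z \<in> ball 0 1 \<Longrightarrow> exp (q * Re (g z)) * (1 - norm z) \<le> C"
proof -
  define M where "M = (SUP r\<in>{0<..<1::real}. \<integral>\<^sup>+ \<xi>. ennreal (cmod (exp (g (of_real r * \<xi>))) powr q) \<partial>circle_measure)"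
  have hole: "(\<lambda>z. exp (g z)) holomorphic_on ball 0 1" using holg by (intro holomorphic_intros)
  have "M < \<infinity>" using mem unfolding hardy_space_def M_def by auto
  then obtain C where C: "M = ennreal C" "0 \<le> C" by (cases M) auto
  have contg: "continuous_on (ball 0 1) g" using holg by (rule holomorphic_on_imp_continuous_on)
  have bound: "exp (q * Re (g (of_real r * z))) * (1 - norm z) \<le> C" if r: "0 < r" "r < 1" and z: "norm z < 1" for r z
  proof -
    note sub = of_real_mult_in_ball[OF r]
    define F where "F = (\<lambda>z. exp (of_real q * g (of_real r * z)))"
    have nF: "norm (F z) = exp (q * Re (g (of_real r * z)))"
      and nF': "norm (F z) = cmod (exp (g (of_real r * z))) powr q" for z
      by (simp_all add: F_def powr_def)
    have "ennreal (integral {0..2 * pi} (\<lambda>t. norm (F (cis t))) / (2 * pi)) \<le> M"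
      unfolding M_def nF' nn_integral_hardy(1)[OF hole \<open>0 < q\<close> r, symmetric]
      by (rule SUP_upper) (use r in auto)
    moreover have "norm (F z) * (1 - norm z) \<le> integral {0..2 * pi} (\<lambda>t. norm (F (cis t))) / (2 * pi)"
    proof (rule norm_le_circle_mean[OF _ _ z])
      show "continuous_on (cball 0 1) F" unfolding F_def
        using sub by (intro continuous_intros continuous_on_compose2[OF contg]) auto
      have "g \<circ> (\<lambda>z. of_real r * z) holomorphic_on ball 0 1"
          using sub by (intro holomorphic_on_compose_gen[OF _ holg] holomorphic_intros) auto
      then show "F holomorphic_on ball 0 1" unfolding F_def
        by (intro holomorphic_intros) (simp_all add: o_def)
    qed
    ultimately have "norm (F z) * (1 - norm z) \<le> C" using C by auto
    then show ?thesis by (simp add: nF)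
  qed
  show ?thesis
  proof (rule that)
    fix z :: complex assume z: "z \<in> ball 0 1"
    have "((\<lambda>r. exp (q * Re (g (of_real r * z))) * (1 - norm z)) \<longlongrightarrow>
            exp (q * Re (g (of_real 1 * z))) * (1 - norm z)) (at_left 1)"
    proof (intro tendsto_intros)
      have "isCont g (of_real 1 * z)" using contg z by (simp add: continuous_on_eq_continuous_at)
      moreover have "((\<lambda>r. of_real r * z) \<longlongrightarrow> of_real 1 * z) (at_left (1::real))" by (intro tendsto_intros)
      ultimately show "((\<lambda>r. g (of_real r * z)) \<longlongrightarrow> g (of_real 1 * z)) (at_left 1)" by (rule isCont_tendsto_compose)
    qed
    moreover have "eventually (\<lambda>r. exp (q * Re (g (of_real r * z))) * (1 - norm z) \<le> C) (at_left 1)"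
      using eventually_at_left_real[of 0 1] bound z by (auto elim: eventually_mono)
    ultimately have "exp (q * Re (g (of_real 1 * z))) * (1 - norm z) \<le> C"
      by (rule tendsto_upperbound) simp
    then show "exp (q * Re (g z)) * (1 - norm z) \<le> C" by simp
  qed
qed

section \<open>Crossing a sector block\<close>

text \<open>The angle between \<open>w\<close> and the positive real axis, cut off at \<open>\<beta>\<close>. Written through the
cosine it is continuous across the negative real axis, where the argument jumps.\<close>

definition truncated_angle :: "real \<Rightarrow> complex \<Rightarrow> real" where
  "truncated_angle \<beta> w = arccos (max (Re w / cmod w) (cos \<beta>))"

lemma truncated_angle:
  assumes "0 < \<beta>" "\<beta> < pi"
  shows "continuous_on (- {0}) (truncated_angle \<beta>)"
    and "0 \<le> truncated_angle \<beta> w" "truncated_angle \<beta> w \<le> \<beta>"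
    and "w \<noteq> 0 \<Longrightarrow> \<bar>Im (Ln w)\<bar> < \<beta> \<Longrightarrow> truncated_angle \<beta> w = \<bar>Im (Ln w)\<bar>"
proof -
  have cb: "-1 \<le> cos \<beta>" "cos \<beta> \<le> 1" by auto
  have r: "Re w / cmod w \<le> 1" "- 1 \<le> Re w / cmod w" for w
    using abs_Re_le_cmod[of w] by (cases "w = 0"; simp add: field_simps abs_le_iff)+
  show "continuous_on (- {0}) (truncated_angle \<beta>)" unfolding truncated_angle_def
    using r cb by (intro continuous_intros) (auto simp: le_max_iff_disj)
  show "0 \<le> truncated_angle \<beta> w" unfolding truncated_angle_def
    using r[of w] cb by (intro arccos_lbound) (auto simp: le_max_iff_disj)
  have "arccos (max (Re w / cmod w) (cos \<beta>)) \<le> arccos (cos \<beta>)"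
    using r[of w] cb by (intro arccos_le_arccos) auto
  then show "truncated_angle \<beta> w \<le> \<beta>" unfolding truncated_angle_def
    using assms by (simp add: arccos_cos)
  assume w: "w \<noteq> 0" and b: "\<bar>Im (Ln w)\<bar> < \<beta>"
  have "Re w = cmod w * cos (Im (Ln w))"
    using Re_exp[of "Ln w"] w by simp
  then have "Re w / cmod w = cos \<bar>Im (Ln w)\<bar>" using w by simp
  moreover have "cos \<beta> \<le> cos \<bar>Im (Ln w)\<bar>" using b assms by (intro cos_monotone_0_pi_le) auto
  ultimately show "truncated_angle \<beta> w = \<bar>Im (Ln w)\<bar>"
    using b assms by (simp add: truncated_angle_def arccos_cos max_absorb1 del: cos_abs_real)
qed

text \<open>The building block of the majorant. In logarithmic coordinates \<open>x + i y\<close>, with \<open>x\<close> measured from the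
inner end of the block, the function \<open>(exp (- s x) / c + c / 4 * exp (s x)) * cos (s y)\<close> is harmonic and, for
\<open>\<bar>y\<bar> < \<beta>\<close>, has these properties: it is at least 1 at \<open>x = 0\<close>, at most 1 at \<open>x = \<delta>\<close>, and at
least \<open>A\<close> at \<open>x = L\<close>. Its minimum with the constant 1 before \<open>\<delta>\<close> and with the constant \<open>A\<close> after
\<open>\<delta>\<close> is therefore superharmonic and joins the constant 1 on the inner side of the block to the
constant \<open>A\<close> on the outer side. Because it is constant there, it continues to the full annuli on
both sides. So crossing a sector block of logarithmic length \<open>L\<close> gains the factor
\<open>exp (s * L)\<close> up to a constant that is independent of \<open>L\<close>.\<close>

lemma sector_factor:
  fixes \<beta> s X L A :: real
  assumes \<beta>: "0 < \<beta>" "\<beta> < pi" and s: "0 < s" "s * \<beta> < pi / 2"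
    and A: "1 \<le> A" "A \<le> (cos (s * \<beta>))\<^sup>2 / 4 * exp (s * L)"
  obtains m :: "complex \<Rightarrow> real" where
    "continuous_on (- {0}) m"
    "\<And>w. cos (s * \<beta>) \<le> m w"
    "\<And>w. w \<noteq> 0 \<Longrightarrow> ln (cmod w) \<le> X \<Longrightarrow> m w = 1"
    "\<And>w. w \<noteq> 0 \<Longrightarrow> X + L \<le> ln (cmod w) \<Longrightarrow> m w = A"
    "\<And>w. w \<noteq> 0 \<Longrightarrow> (X \<le> ln (cmod w) \<and> ln (cmod w) \<le> X + L \<longrightarrow> \<bar>Im (Ln w)\<bar> < \<beta>)
        \<Longrightarrow> harmonic_above m w"
proof -
  define c where "c = cos (s * \<beta>)"
  have c: "0 < c" "c \<le> 1" using \<beta> s by (auto simp: c_def intro: cos_gt_zero)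
  \<comment> \<open>The position where the two exponential terms of \<open>E\<close> below both equal one half.\<close>
  define \<delta> where "\<delta> = ln (2 / c) / s"
  have exp\<delta>: "exp (s * \<delta>) = 2 / c" using s c by (simp add: \<delta>_def)
  have exp\<delta>': "exp (- (s * \<delta>)) = c / 2" using exp\<delta> by (simp add: exp_minus)
  have \<delta>0: "\<delta> > 0" using c s by (simp add: \<delta>_def)
  have \<delta>L: "\<delta> \<le> L"
  proof -
    have "1 \<le> c\<^sup>2 / 4 * exp (s * L)" using A unfolding c_def by simp
    then have "4 / c\<^sup>2 \<le> exp (s * L)" using c by (simp add: field_simps)
    moreover have "2 / c \<le> 4 / c\<^sup>2" using c by (simp add: field_simps power2_eq_square)
    ultimately have "exp (s * \<delta>) \<le> exp (s * L)" using exp\<delta> by simp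
    then show ?thesis using s by simp
  qed
  define x where "x = (\<lambda>w. ln (cmod w) - X)"
  define E where "E = (\<lambda>x. exp (- (s * x)) / c + c / 4 * exp (s * x))"
  define W where "W = (\<lambda>w. E (x w) * cos (s * truncated_angle \<beta> w))"
  define m where "m = (\<lambda>w. if x w \<le> \<delta> then min (W w) 1 else min (W w) A)"
  have Epos: "E t > 0" for t using c by (simp add: E_def add_pos_pos)
  have cosb: "c \<le> cos (s * truncated_angle \<beta> w)" for w
  proof -
    have "s * \<beta> \<le> pi" using s pi_gt_zero by linarith
    then show ?thesis
      unfolding c_def using truncated_angle(2,3)[OF \<beta>, of w] s
      by (intro cos_monotone_0_pi_le) (auto simp: mult_left_mono)
  qed
  \<comment> \<open>Arithmetic and geometric mean: the two terms have product one quarter.\<close>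
  have E1: "1 \<le> E t" for t
  proof -
    define a where "a = exp (s * t)"
    have a: "a > 0" by (simp add: a_def)
    have "E t - 1 = (2 - c * a)\<^sup>2 / (4 * c * a)"
      using a c unfolding E_def exp_minus a_def[symmetric] by (simp add: field_simps power2_eq_square)
    also have "\<dots> \<ge> 0" using a c by simp
    finally show ?thesis by simp
  qed
  have Wc: "c \<le> W w" for w
    using mult_mono[OF E1[of "x w"] cosb[of w]] c Epos[of "x w"] by (simp add: W_def)
  have Wle: "W w \<le> E (x w)" for w
    using mult_left_mono[OF cos_le_one, of "E (x w)" "s * truncated_angle \<beta> w"] Epos[of "x w"] by (simp add: W_def)
  have W1: "1 \<le> W w" if "x w \<le> 0" for w
  proof -
    have "1 = 1 / c * c" using c by simp
    also have "\<dots> \<le> exp (- (s * x w)) / c * c"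
      using c that s by (intro mult_right_mono divide_right_mono) (auto simp: mult_nonneg_nonpos)
    also have "\<dots> \<le> E (x w) * c" using c by (intro mult_right_mono) (auto simp: E_def)
    also have "\<dots> \<le> W w" unfolding W_def using cosb Epos[of "x w"] by (intro mult_left_mono) auto
    finally show ?thesis .
  qed
  have WA: "A \<le> W w" if "L \<le> x w" for w
  proof -
    have "A \<le> c / 4 * exp (s * L) * c" using A by (simp add: c_def power2_eq_square mult_ac)
    also have "\<dots> \<le> c / 4 * exp (s * x w) * c"
      using c that s by (intro mult_right_mono mult_left_mono) auto
    also have "\<dots> \<le> E (x w) * c" using c by (intro mult_right_mono) (auto simp: E_def)
    also have "\<dots> \<le> W w" unfolding W_def using cosb Epos[of "x w"] by (intro mult_left_mono) auto
    finally show ?thesis .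
  qed
  have W\<delta>: "W w \<le> 1" if "x w = \<delta>" for w
  proof -
    have "E \<delta> = 1" using c by (simp add: E_def exp\<delta> exp\<delta>')
    then show ?thesis using Wle[of w] that by simp
  qed
  have contx: "continuous_on (- {0}) x" unfolding x_def by (intro continuous_intros) auto
  have contE: "continuous_on UNIV E" unfolding E_def using c by (intro continuous_intros) auto
  have contW: "continuous_on (- {0}) W" unfolding W_def
    by (intro continuous_intros continuous_on_compose2[OF contE contx] truncated_angle(1)[OF \<beta>]) auto
  have contm: "continuous_on (- {0}) m" unfolding m_def
  proof (rule continuous_on_cases_le[OF _ _ contx])
    show "continuous_on {w \<in> - {0}. x w \<le> \<delta>} (\<lambda>w. min (W w) 1)"
      by (intro continuous_intros continuous_on_subset[OF contW]) auto
    show "continuous_on {w \<in> - {0}. \<delta> \<le> x w} (\<lambda>w. min (W w) A)"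
      by (intro continuous_intros continuous_on_subset[OF contW]) auto
    show "min (W w) 1 = min (W w) A" if "x w = \<delta>" for w
      using W\<delta>[OF that] A by simp
  qed
  have above: "harmonic_above m w"
    if w: "w \<noteq> 0" and sector: "X \<le> ln (cmod w) \<and> ln (cmod w) \<le> X + L \<longrightarrow> \<bar>Im (Ln w)\<bar> < \<beta>" for w
  proof -
    consider (one) "x w < \<delta>" "m w = 1" | (A) "\<delta> < x w" "m w = A"
      | (W) "m w = W w" "0 \<le> x w" "x w \<le> L"
      using W1[of w] WA[of w] W\<delta>[of w] \<delta>0 \<delta>L A(1) unfolding m_def by (fastforce simp: min_def split: if_splits)
    then show ?thesis
    proof cases
      case one
      have "open ((- {0}) \<inter> x -` {..<\<delta>})" by (intro continuous_open_preimage[OF contx]) auto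
      then show ?thesis
        by (rule harmonic_aboveI[where \<phi> = "\<lambda>_. 1"]) (use one w in \<open>auto simp: m_def\<close>)
    next
      case A
      have "open ((- {0}) \<inter> x -` {\<delta><..})" by (intro continuous_open_preimage[OF contx]) auto
      then show ?thesis
        by (rule harmonic_aboveI[where \<phi> = "\<lambda>_. of_real A"]) (use A w in \<open>auto simp: m_def\<close>)
    next
      case W
      define T where "T = (- \<real>\<^sub>\<le>\<^sub>0) \<inter> (\<lambda>z. Im (Ln z)) -` {- \<beta><..<\<beta>}"
      have "open T" unfolding T_def
        by (intro continuous_open_preimage continuous_intros) (auto simp: closed_nonpos_Reals_complex open_Compl)
      moreover have "w \<in> T"
      proof -
        have "\<bar>Im (Ln w)\<bar> < \<beta>" using sector W by (simp add: x_def)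
        moreover have "w \<notin> \<real>\<^sub>\<le>\<^sub>0"
        proof
          assume "w \<in> \<real>\<^sub>\<le>\<^sub>0"
          then have "Im (Ln w) = pi" using w by (metis Im_Ln_eq_pi complex_nonpos_Reals_iff complex_eq_iff le_less zero_complex.sel)
          then show False using \<open>\<bar>Im (Ln w)\<bar> < \<beta>\<close> \<beta> by simp
        qed
        ultimately show ?thesis by (auto simp: T_def)
      qed
      moreover define \<phi> where "\<phi> = (\<lambda>z. exp (- (of_real s * (Ln z - of_real X))) / of_real c
          + of_real (c / 4) * exp (of_real s * (Ln z - of_real X)))"
      have hol: "\<phi> holomorphic_on T" unfolding \<phi>_def T_def using c by (intro holomorphic_intros) auto
      have ReW: "Re (\<phi> z) = W z" if "z \<in> T" for z
      proof -
        have z0: "z \<noteq> 0" using that by (auto simp: T_def)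
        have "truncated_angle \<beta> z = \<bar>Im (Ln z)\<bar>"
          using that z0 by (intro truncated_angle(4)[OF \<beta>]) (auto simp: T_def)
        then have "cos (s * truncated_angle \<beta> z) = cos (s * Im (Ln z))"
          using s cos_abs_real[of "s * Im (Ln z)"] by (simp add: abs_mult)
        then show ?thesis using z0
          by (simp add: \<phi>_def W_def E_def x_def Re_exp Re_divide_of_real algebra_simps)
      qed
      ultimately show ?thesis
        by (rule_tac harmonic_aboveI[where T = T and \<phi> = \<phi>]) (use W(1) hol ReW in \<open>auto simp: m_def\<close>)
    qed
  qed
  show ?thesis
  proof (rule that[of m])
    have "c \<le> A" using c A by simp
    then show "cos (s * \<beta>) \<le> m w" for w using Wc[of w] c unfolding c_def[symmetric] m_def by auto
    show "m w = 1" if "ln (cmod w) \<le> X" for w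
      using W1[of w] that \<delta>0 by (simp add: m_def x_def)
    show "m w = A" if "X + L \<le> ln (cmod w)" for w
      using WA[of w] W\<delta>[of w] that \<delta>L A(1) by (auto simp: m_def x_def)
  qed (use contm above in auto)
qed

section \<open>The domain and the lower bound for its Hardy number\<close>

text \<open>Logarithmic coordinates of the domain: on the blocks \<open>{n^2..n^2 + 2 p n / (p + 1)}\<close> of the real part
only a strip is kept, and everything on the gaps between the blocks. The exponential
maps the strip onto a sector whose Hardy number is \<open>p + 1\<close>, and the blocks occupy the
proportion \<open>p / (p + 1)\<close> of the logarithmic scale.\<close>

definition comb :: "real \<Rightarrow> complex set" where
  "comb p = {\<zeta>. \<forall>n::nat. (real n)\<^sup>2 \<le> Re \<zeta> \<and> Re \<zeta> \<le> (real n)\<^sup>2 + 2 * p / (p + 1) * real n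
     \<longrightarrow> \<bar>Im \<zeta>\<bar> < pi / (2 * (p + 1))}"

lemma square_block_less:
  assumes "0 < p"
  shows "(real n)\<^sup>2 + 2 * p / (p + 1) * real n < (real (Suc n))\<^sup>2"
proof -
  have "2 * p / (p + 1) \<le> 2" using assms by (simp add: field_simps)
  then have "2 * p / (p + 1) * real n \<le> 2 * real n" by (rule mult_right_mono) simp
  then show ?thesis by (simp add: power2_eq_square algebra_simps)
qed

text \<open>The majorant is the product of one factor from \<open>sector_factor\<close> per block. At any point all factors but
one are locally constant, so the product inherits the superharmonicity of that one.
For \<open>s\<close> slightly below \<open>p + 1\<close> the factor of the \<open>k\<close>-th block may gain almost
\<open>exp (2 * p * k)\<close>; for large \<open>k\<close> this exceeds the growth \<open>exp (q * (2 * k + 3))\<close> of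
\<open>exp (q * (k + 1)^2)\<close> from one index to the next, constants included. The index is shifted
by one because the value at the inner end of a block has to dominate \<open>cmod w powr q\<close> up to the end
of the following gap.\<close>

lemma superharmonic_majorant_exp_comb:
  assumes q: "0 < q" "q < p"
  obtains U where "continuous_on (exp ` comb p) U"
    "\<And>w. w \<in> exp ` comb p \<Longrightarrow> harmonic_above U w"
    "\<And>w. w \<in> exp ` comb p \<Longrightarrow> cmod w powr q \<le> U w"
proof -
  have p: "0 < p" using q by simp
  \<comment> \<open>Any \<open>t\<close> strictly between \<open>q / p\<close> and 1 would do.\<close>
  define t where "t = (1 + q / p) / 2"
  have t: "0 < t" "t < 1" "q < t * p" using q p by (auto simp: t_def field_simps)
  define s where "s = t * (p + 1)"
  define \<beta> where "\<beta> = pi / (2 * (p + 1))"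
  define L where "L = (\<lambda>k::nat. 2 * p / (p + 1) * real k)"
  define X where "X = (\<lambda>k::nat. (real k)\<^sup>2)"
  define A where "A = (\<lambda>k::nat. exp (q * (2 * real k + 3)))"
  have s: "0 < s" using t p by (simp add: s_def)
  have s\<beta>: "s * \<beta> = t * (pi / 2)" using p by (simp add: s_def \<beta>_def field_simps)
  then have s\<beta>': "s * \<beta> < pi / 2" using t by simp
  have \<beta>: "0 < \<beta>" "\<beta> < pi" using p by (auto simp: \<beta>_def field_simps intro!: add_pos_pos mult_pos_pos)
  have sL: "s * L k = 2 * t * p * real k" for k using p by (simp add: s_def L_def field_simps)
  define c where "c = cos (s * \<beta>)"
  have c: "0 < c" "c \<le> 1" using \<beta> s s\<beta>' by (auto simp: c_def intro: cos_gt_zero)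
  obtain N :: nat where N: "(3 * q + ln (4 / c\<^sup>2)) / (2 * (t * p - q)) \<le> real N"
    using real_arch_simple by blast
  have A: "1 \<le> A k" "A k \<le> c\<^sup>2 / 4 * exp (s * L k)" if "N \<le> k" for k
  proof -
    show "1 \<le> A k" using q by (simp add: A_def)
    have "(3 * q + ln (4 / c\<^sup>2)) / (2 * (t * p - q)) \<le> real k" using N that by simp
    then have "3 * q + ln (4 / c\<^sup>2) \<le> real k * (2 * (t * p - q))"
      using t by (simp add: pos_divide_le_eq)
    then have "q * (2 * real k + 3) \<le> - ln (4 / c\<^sup>2) + s * L k"
      unfolding sL by (simp add: algebra_simps)
    then have "A k \<le> exp (- ln (4 / c\<^sup>2) + s * L k)" by (simp add: A_def)
    also have "\<dots> = c\<^sup>2 / 4 * exp (s * L k)" using c unfolding exp_add exp_minus by simp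
    finally show "A k \<le> c\<^sup>2 / 4 * exp (s * L k)" .
  qed
  have "\<forall>k\<in>{N..}. \<exists>m :: complex \<Rightarrow> real. continuous_on (- {0}) m \<and> (\<forall>w. c \<le> m w) \<and>
      (\<forall>w. w \<noteq> 0 \<longrightarrow> ln (cmod w) \<le> X k \<longrightarrow> m w = 1) \<and>
      (\<forall>w. w \<noteq> 0 \<longrightarrow> X k + L k \<le> ln (cmod w) \<longrightarrow> m w = A k) \<and>
      (\<forall>w. w \<noteq> 0 \<longrightarrow> (X k \<le> ln (cmod w) \<and> ln (cmod w) \<le> X k + L k \<longrightarrow> \<bar>Im (Ln w)\<bar> < \<beta>)
        \<longrightarrow> harmonic_above m w)"
  proof
    fix k assume "k \<in> {N..}"
    then have "N \<le> k" by simp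
    show "\<exists>m :: complex \<Rightarrow> real. continuous_on (- {0}) m \<and> (\<forall>w. c \<le> m w) \<and>
      (\<forall>w. w \<noteq> 0 \<longrightarrow> ln (cmod w) \<le> X k \<longrightarrow> m w = 1) \<and>
      (\<forall>w. w \<noteq> 0 \<longrightarrow> X k + L k \<le> ln (cmod w) \<longrightarrow> m w = A k) \<and>
      (\<forall>w. w \<noteq> 0 \<longrightarrow> (X k \<le> ln (cmod w) \<and> ln (cmod w) \<le> X k + L k \<longrightarrow> \<bar>Im (Ln w)\<bar> < \<beta>)
        \<longrightarrow> harmonic_above m w)"
      by (rule sector_factor[OF \<beta> s s\<beta>' A(1)[OF \<open>N \<le> k\<close>] A(2)[OF \<open>N \<le> k\<close>, unfolded c_def], of "X k"])
         (auto simp: c_def)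
  qed
  then obtain m where "\<forall>k\<in>{N..}. continuous_on (- {0}) (m k) \<and> (\<forall>w. c \<le> m k w) \<and>
      (\<forall>w. w \<noteq> 0 \<longrightarrow> ln (cmod w) \<le> X k \<longrightarrow> m k w = 1) \<and>
      (\<forall>w. w \<noteq> 0 \<longrightarrow> X k + L k \<le> ln (cmod w) \<longrightarrow> m k w = A k) \<and>
      (\<forall>w. w \<noteq> 0 \<longrightarrow> (X k \<le> ln (cmod w) \<and> ln (cmod w) \<le> X k + L k \<longrightarrow> \<bar>Im (Ln w)\<bar> < \<beta>)
        \<longrightarrow> harmonic_above (m k) w)"
    unfolding bchoice_iff by blast
  then have m: "continuous_on (- {0}) (m k)" "c \<le> m k w"
      "w \<noteq> 0 \<Longrightarrow> ln (cmod w) \<le> X k \<Longrightarrow> m k w = 1"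
      "w \<noteq> 0 \<Longrightarrow> X k + L k \<le> ln (cmod w) \<Longrightarrow> m k w = A k"
      "w \<noteq> 0 \<Longrightarrow> (X k \<le> ln (cmod w) \<and> ln (cmod w) \<le> X k + L k \<longrightarrow> \<bar>Im (Ln w)\<bar> < \<beta>)
        \<Longrightarrow> harmonic_above (m k) w" if "N \<le> k" for k w
    using that by auto
  have XS: "X n + L n < X (Suc n)" for n using square_block_less[OF p, of n] by (simp add: X_def L_def)
  have Xmono: "X i \<le> X j" if "i \<le> j" for i j using that by (simp add: X_def power_mono)
  have Xge: "real n \<le> X n" for n
    unfolding X_def using of_nat_mono[OF le_square[of n], where 'a = real] by (simp add: power2_eq_square)
  define C where "C = exp (q * (real N + 1)\<^sup>2) / c"
  have C: "C > 0" "exp (q * (real N + 1)\<^sup>2) \<le> C" "C * c = exp (q * (real N + 1)\<^sup>2)"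
    using c by (auto simp: C_def field_simps)
  \<comment> \<open>Only blocks that start before \<open>ln (cmod w)\<close> contribute, so the product is finite;
    any larger range of indices gives the same value.\<close>
  define I where "I = (\<lambda>w. nat \<lceil>ln (cmod w)\<rceil> + 1)"
  define U where "U = (\<lambda>w. C * (\<Prod>k\<in>{N..<I w}. m k w))"
  have I: "ln (cmod w) < X (I w)" for w using Xge[of "I w"] unfolding I_def by linarith
  have U_eq: "U w = C * (\<Prod>k\<in>{N..<M}. m k w)" if "w \<noteq> 0" "ln (cmod w) \<le> X M" for w M
  proof -
    have one: "m k w = 1" if "N \<le> k" "M \<le> k \<or> I w \<le> k" for k
      using that \<open>w \<noteq> 0\<close> Xmono[of M k] Xmono[of "I w" k] I[of w] \<open>ln (cmod w) \<le> X M\<close>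
      by (intro m(3)) auto
    have "(\<Prod>k\<in>{N..<I w}. m k w) = (\<Prod>k\<in>{N..<max M (I w)}. m k w)"
      by (rule prod.mono_neutral_left) (auto simp: one)
    also have "\<dots> = (\<Prod>k\<in>{N..<M}. m k w)"
      by (rule prod.mono_neutral_right) (auto simp: one)
    finally show ?thesis by (simp add: U_def)
  qed
  have contln: "continuous_on (- {0}) (\<lambda>w::complex. ln (cmod w))" by (intro continuous_intros) auto
  have contU: "continuous_on (- {0}) U"
  proof (rule continuous_at_imp_continuous_on, rule ballI)
    fix w :: complex assume "w \<in> - {0}"
    define T where "T = (- {0}) \<inter> (\<lambda>w. ln (cmod w)) -` {..<X (I w)}"
    have T: "open T" unfolding T_def by (intro continuous_open_preimage[OF contln]) auto
    have wT: "w \<in> T" using I[of w] \<open>w \<in> - {0}\<close> by (simp add: T_def)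
    have "continuous_on T (\<lambda>z. C * (\<Prod>k\<in>{N..<I w}. m k z))"
      by (intro continuous_intros continuous_on_subset[OF m(1)]) (auto simp: T_def)
    then have "continuous_on T U"
      by (rule continuous_on_eq) (auto simp: T_def U_eq[symmetric])
    then show "isCont U w" using T wT by (simp add: continuous_on_eq_continuous_at)
  qed
  have above_major: "harmonic_above U w \<and> cmod w powr q \<le> U w" if w: "w \<in> exp ` comb p" for w
  proof -
    have w0: "w \<noteq> 0" using w by auto
    obtain \<zeta> where \<zeta>: "\<zeta> \<in> comb p" "w = exp \<zeta>" using w by auto
    define x where "x = ln (cmod w)"
    have ex: "\<exists>n. x \<le> X n + L n"
    proof -
      have "0 \<le> L (I w)" using p by (simp add: L_def)
      then show ?thesis using I[of w] by (intro exI[of _ "I w"]) (simp add: x_def)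
    qed
    \<comment> \<open>The \<open>n\<close>-th factor is the one that may fail to be locally constant at \<open>w\<close>.\<close>
    define n where "n = (LEAST n. x \<le> X n + L n)"
    have n: "x \<le> X n + L n" unfolding n_def using ex by (rule LeastI_ex)
    have least: "X k + L k < x" if "k < n" for k
      using not_less_Least[OF that[unfolded n_def]] by simp
    have sector: "\<bar>Im (Ln w)\<bar> < \<beta>" if "X n \<le> ln (cmod w)" "ln (cmod w) \<le> X n + L n"
    proof -
      have "\<bar>Im \<zeta>\<bar> < \<beta>" using that \<zeta> by (auto simp: comb_def X_def L_def \<beta>_def)
      moreover from this have "Ln w = \<zeta>" using \<beta> \<zeta> by (auto intro!: Ln_exp)
      ultimately show ?thesis by simp
    qed
    define T where "T = (- {0}) \<inter> (\<lambda>w. ln (cmod w)) -` ({..<X (Suc n)} \<inter> (\<Inter>k<n. {X k + L k<..}))"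
    have T: "open T" unfolding T_def by (intro continuous_open_preimage[OF contln] open_Int open_INT) auto
    have wT: "w \<in> T" using w0 n least XS[of n] by (auto simp: T_def x_def)
    have lo: "m k z = A k" if "z \<in> T" "N \<le> k" "k < n" for z k
      using that by (intro m(4)) (auto simp: T_def less_imp_le)
    have UT: "U z = C * (\<Prod>k\<in>{N..<Suc n}. m k z)" if "z \<in> T" for z
      using that by (intro U_eq) (auto simp: T_def)
    show ?thesis
    proof (cases "N \<le> n")
      case True
      define P where "P = C * (\<Prod>k\<in>{N..<n}. A k)"
      have P0: "0 \<le> P" unfolding P_def using C by (intro mult_nonneg_nonneg prod_nonneg) (auto simp: A_def)
      have UP: "U z = P * m n z" if "z \<in> T" for z
      proof -
        have "(\<Prod>k\<in>{N..<Suc n}. m k z) = (\<Prod>k\<in>{N..<n}. m k z) * m n z"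
          using True by simp
        also have "(\<Prod>k\<in>{N..<n}. m k z) = (\<Prod>k\<in>{N..<n}. A k)"
          by (rule prod.cong) (use lo[OF that] in auto)
        finally show ?thesis unfolding UT[OF that] P_def by (simp only: mult.assoc)
      qed
      have "harmonic_above U w"
      proof (rule harmonic_above_cong[OF m(5)[OF True w0] T wT _ P0])
        show "X n \<le> ln (cmod w) \<and> ln (cmod w) \<le> X n + L n \<longrightarrow> \<bar>Im (Ln w)\<bar> < \<beta>"
          using sector by blast
      qed (rule UP)
      moreover have "cmod w powr q \<le> U w"
      proof -
        have prod: "(\<Prod>k\<in>{N..<n}. A k) = exp (q * ((real n + 1)\<^sup>2 - (real N + 1)\<^sup>2))"
          using True
        proof (induction n rule: dec_induct)
          case (step n)
          have "(\<Prod>k\<in>{N..<Suc n}. A k) = (\<Prod>k\<in>{N..<n}. A k) * A n"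
            using step.hyps by simp
          also have "\<dots> = exp (q * ((real n + 1)\<^sup>2 - (real N + 1)\<^sup>2) + q * (2 * real n + 3))"
            unfolding step.IH exp_add by (simp only: A_def)
          also have "q * ((real n + 1)\<^sup>2 - (real N + 1)\<^sup>2) + q * (2 * real n + 3)
              = q * ((real (Suc n) + 1)\<^sup>2 - (real N + 1)\<^sup>2)"
            by (simp add: power2_eq_square algebra_simps)
          finally show ?case .
        qed simp
        have "cmod w powr q = exp (q * x)" using w0 by (simp add: powr_def x_def)
        also have "\<dots> \<le> exp (q * (real n + 1)\<^sup>2)"
          using n XS[of n] q by (simp add: X_def add.commute)
        also have "\<dots> = exp (q * (real N + 1)\<^sup>2 + q * ((real n + 1)\<^sup>2 - (real N + 1)\<^sup>2))"
          by (simp add: algebra_simps)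
        also have "\<dots> = P * c" unfolding P_def prod exp_add C(3)[symmetric] by (simp only: mult_ac)
        also have "\<dots> \<le> P * m n w" using m(2)[OF True] P0 by (rule mult_left_mono)
        finally show ?thesis using UP[OF wT] by simp
      qed
      ultimately show ?thesis ..
    next
      case False
      then have UC: "U z = C" if "z \<in> T" for z using UT[OF that] by simp
      have "harmonic_above U w"
        by (rule harmonic_aboveI[OF T wT, where \<phi> = "\<lambda>_. of_real C"]) (use UC wT in auto)
      moreover have "cmod w powr q \<le> U w"
      proof -
        have "X (Suc n) \<le> (real N + 1)\<^sup>2" using False unfolding X_def by (intro power_mono) auto
        then have "exp (q * x) \<le> exp (q * (real N + 1)\<^sup>2)" using n XS[of n] q by simp
        also note C(2)
        also have "C = U w" using UC[OF wT] by simp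
        finally show ?thesis using w0 by (simp add: powr_def x_def)
      qed
      ultimately show ?thesis ..
    qed
  qed
  show ?thesis
    by (rule that[of U]) (use above_major in \<open>auto intro: continuous_on_subset[OF contU]\<close>)
qed

section \<open>Topology of the comb\<close>

lemma strip_subset_comb: "\<bar>Im \<zeta>\<bar> < pi / (2 * (p + 1)) \<Longrightarrow> \<zeta> \<in> comb p"
  by (simp add: comb_def)

lemma open_comb: "open (comb p)"
proof (rule Topological_Spaces.openI)
  fix \<zeta> assume \<zeta>: "\<zeta> \<in> comb p"
  obtain M :: nat where M: "\<bar>Re \<zeta>\<bar> + 1 \<le> real M" using real_arch_simple by blast
  define V where "V = (\<lambda>n. {z. Re z < (real n)\<^sup>2} \<union> {z. (real n)\<^sup>2 + 2 * p / (p + 1) * real n < Re z}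
      \<union> {z. \<bar>Im z\<bar> < pi / (2 * (p + 1))})"
  define T where "T = {z. Re z < real M} \<inter> (\<Inter>n<M. V n)"
  have "open T" unfolding T_def V_def
    by (intro open_Int open_INT open_Un ballI finite_lessThan open_Collect_less continuous_intros)
  moreover have "\<zeta> \<in> T" using \<zeta> M by (auto simp: T_def V_def comb_def not_less)
  moreover have "T \<subseteq> comb p"
  proof
    fix z assume z: "z \<in> T"
    show "z \<in> comb p" unfolding comb_def
    proof (intro CollectI allI impI, elim conjE)
      fix n :: nat assume n: "(real n)\<^sup>2 \<le> Re z" "Re z \<le> (real n)\<^sup>2 + 2 * p / (p + 1) * real n"
      have "n < M"
      proof (rule ccontr)
        assume "\<not> n < M"
        then have "real M \<le> real n" by simp
        also have "\<dots> \<le> (real n)\<^sup>2"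
          using of_nat_mono[OF le_square[of n], where 'a = real] by (simp add: power2_eq_square)
        finally have "real M \<le> (real n)\<^sup>2" .
        moreover have "Re z < real M" using z by (simp add: T_def)
        ultimately show False using n by linarith
      qed
      then have "z \<in> V n" using z by (auto simp: T_def)
      then show "\<bar>Im z\<bar> < pi / (2 * (p + 1))" using n by (auto simp: V_def)
    qed
  qed
  ultimately show "\<exists>T. open T \<and> \<zeta> \<in> T \<and> T \<subseteq> comb p" by blast
qed

text \<open>The comb is vertically star-shaped over the real axis, which it contains.\<close>

lemma contractible_comb:
  assumes "0 < p"
  shows "contractible (comb p)"
proof -
  have real_in: "of_real x \<in> comb p" for x using assms by (intro strip_subset_comb) simp
  have "homotopic_with_canon (\<lambda>_. True) (comb p) (comb p) id (\<lambda>z. of_real (Re z))"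
  proof (rule homotopic_with_linear)
    show "closed_segment (id z) (of_real (Re z)) \<subseteq> comb p" if z: "z \<in> comb p" for z
    proof
      fix y assume "y \<in> closed_segment (id z) (of_real (Re z))"
      then obtain u where u: "0 \<le> u" "u \<le> 1" "y = (1 - u) *\<^sub>R z + u *\<^sub>R of_real (Re z)"
        unfolding closed_segment_def by auto
      have "Re y = Re z" unfolding u(3) by (simp add: algebra_simps)
      moreover have "\<bar>Im y\<bar> \<le> \<bar>Im z\<bar>" unfolding u(3) using u(1,2) by (simp add: abs_mult mult_left_le_one_le)
      ultimately show "y \<in> comb p" using z unfolding comb_def by force
    qed
  qed (intro continuous_intros)+
  moreover have "homotopic_with_canon (\<lambda>_. True) (comb p) (comb p) (\<lambda>z. of_real (Re z)) (\<lambda>_. 0)"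
  proof (rule homotopic_with_linear)
    show "closed_segment (of_real (Re z)) 0 \<subseteq> comb p" for z
    proof
      fix y assume "y \<in> closed_segment (complex_of_real (Re z)) 0"
      then have "y = of_real (Re y)" by (auto simp: closed_segment_def complex_eq_iff)
      then show "y \<in> comb p" using real_in by metis
    qed
  qed (intro continuous_intros)+
  ultimately show ?thesis unfolding contractible_def using homotopic_with_trans by blast
qed

lemma comb_neq_UNIV:
  assumes "0 < p"
  shows "comb p \<noteq> UNIV"
proof -
  have "pi / (2 * (p + 1)) \<le> pi / 1" using assms by (intro divide_left_mono) auto
  then have "Complex 1 pi \<notin> comb p"
    using assms unfolding comb_def by (auto intro!: exI[of _ 1])
  then show ?thesis by blast
qed

lemma ball_in_gap_subset_comb:
  assumes "0 < p" and a: "a = (real n)\<^sup>2 + 2 * p / (p + 1) * real n"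
    and b: "b = (real (Suc n))\<^sup>2"
  shows "ball (of_real ((a + b) / 2)) ((b - a) / 2) \<subseteq> comb p"
proof
  fix z :: complex assume "z \<in> ball (of_real ((a + b) / 2)) ((b - a) / 2)"
  then have "\<bar>Re (z - of_real ((a + b) / 2))\<bar> < (b - a) / 2"
    using abs_Re_le_cmod[of "z - of_real ((a + b) / 2)"] by (simp add: dist_norm norm_minus_commute)
  then have z: "a < Re z" "Re z < b" by (auto simp: field_simps abs_less_iff)
  show "z \<in> comb p" unfolding comb_def
  proof (intro CollectI allI impI, elim conjE)
    fix k :: nat assume k: "(real k)\<^sup>2 \<le> Re z" "Re z \<le> (real k)\<^sup>2 + 2 * p / (p + 1) * real k"
    have "False"
    proof (cases "k \<le> n")
      case True
      have "(real k)\<^sup>2 \<le> (real n)\<^sup>2" using True by (intro power_mono) auto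
      moreover have "2 * p / (p + 1) * real k \<le> 2 * p / (p + 1) * real n"
        using True assms(1) by (intro mult_left_mono) auto
      ultimately show False using k z a by linarith
    next
      case False
      have "(real (Suc n))\<^sup>2 \<le> (real k)\<^sup>2" using False by (intro power_mono) auto
      then show False using k z b by linarith
    qed
    then show "\<bar>Im z\<bar> < pi / (2 * (p + 1))" ..
  qed
qed

section \<open>Hyperbolic distance and the upper bound\<close>

text \<open>The exponential of the hyperbolic distance (curvature \<open>-1\<close>) from \<open>0\<close> to \<open>z\<close>, so that the
triangle inequality becomes submultiplicativity. It is at least the inverse distance to the boundary.\<close>

definition bdry_ratio :: "complex \<Rightarrow> real" where
  "bdry_ratio z = (1 + norm z) / (1 - norm z)"

text \<open>The triangle inequality for the hyperbolic distance; the hypothesis says that the pseudo-hyperbolic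
distance of \<open>a\<close> and \<open>b\<close> is at most \<open>norm t\<close>.\<close>

lemma bdry_ratio_le_mult:
  assumes a: "norm a < 1" and b: "norm b < 1" and t: "norm t < 1"
    and le: "norm (b - a) \<le> norm t * norm (1 - cnj a * b)"
  shows "bdry_ratio b \<le> bdry_ratio a * bdry_ratio t"
proof -
  define \<alpha> \<beta> \<tau> where "\<alpha> = norm a" and "\<beta> = norm b" and "\<tau> = norm t"
  have r: "0 \<le> \<alpha>" "\<alpha> < 1" "0 \<le> \<beta>" "\<beta> < 1" "0 \<le> \<tau>" "\<tau> < 1"
    using a b t by (auto simp: \<alpha>_def \<beta>_def \<tau>_def)
  define D where "D = (norm (1 - cnj a * b))\<^sup>2"
  have id: "(norm (b - a))\<^sup>2 = D - (1 - \<alpha>\<^sup>2) * (1 - \<beta>\<^sup>2)"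
    unfolding D_def \<alpha>_def \<beta>_def cmod_power2 by (simp add: power2_eq_square algebra_simps)
  have \<alpha>\<beta>: "\<alpha> * \<beta> \<le> 1" using r by (simp add: mult_le_one)
  have "1 - \<alpha> * \<beta> \<le> norm (1 - cnj a * b)"
    using norm_triangle_ineq2[of 1 "cnj a * b"] by (simp add: norm_mult \<alpha>_def \<beta>_def)
  then have D: "(1 - \<alpha> * \<beta>)\<^sup>2 \<le> D" unfolding D_def using \<alpha>\<beta> by (intro power_mono) auto
  have "(norm (b - a))\<^sup>2 \<le> \<tau>\<^sup>2 * D"
    unfolding D_def \<tau>_def power_mult_distrib[symmetric] using le by (intro power_mono) auto
  then have "D * (1 - \<tau>\<^sup>2) \<le> (1 - \<alpha>\<^sup>2) * (1 - \<beta>\<^sup>2)" using id by (simp add: algebra_simps)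
  moreover have "(1 - \<alpha> * \<beta>)\<^sup>2 * (1 - \<tau>\<^sup>2) \<le> D * (1 - \<tau>\<^sup>2)"
    using D r by (intro mult_right_mono) (auto simp: power_le_one)
  ultimately have "(\<beta> - \<alpha>)\<^sup>2 \<le> (\<tau> * (1 - \<alpha> * \<beta>))\<^sup>2"
    by (simp add: power2_eq_square algebra_simps)
  then have "\<beta> - \<alpha> \<le> \<tau> * (1 - \<alpha> * \<beta>)"
    by (rule power2_le_imp_le) (use r \<alpha>\<beta> in auto)
  then have "(1 + \<beta>) * ((1 - \<alpha>) * (1 - \<tau>)) \<le> ((1 + \<alpha>) * (1 + \<tau>)) * (1 - \<beta>)"
    by (simp add: algebra_simps)
  then have "(1 + \<beta>) / (1 - \<beta>) \<le> ((1 + \<alpha>) * (1 + \<tau>)) / ((1 - \<alpha>) * (1 - \<tau>))"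
    using r by (simp add: divide_le_eq le_divide_eq pos_divide_le_eq pos_le_divide_eq mult_ac)
  then show ?thesis by (simp add: bdry_ratio_def \<alpha>_def \<beta>_def \<tau>_def)
qed

lemma Schwarz_Pick_bdry_ratio:
  assumes holG: "G holomorphic_on S" and G: "G ` S \<subseteq> ball 0 1"
    and holk: "k holomorphic_on ball 0 1" and k: "k ` ball 0 1 \<subseteq> S" and t: "norm t < 1"
  shows "bdry_ratio (G (k t)) \<le> bdry_ratio (G (k 0)) * bdry_ratio t"
    and "bdry_ratio (G (k 0)) \<le> bdry_ratio (G (k t)) * bdry_ratio t"
proof -
  define a b where "a = G (k 0)" and "b = G (k t)"
  have Gk: "norm (G (k z)) < 1" if "norm z < 1" for z using that G k by (force simp: image_subset_iff)
  have a: "norm a < 1" and b: "norm b < 1" using Gk t by (auto simp: a_def b_def)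
  have nz: "1 - cnj a * z \<noteq> 0" if "norm z < 1" for z
  proof
    assume "1 - cnj a * z = 0"
    then have "norm (cnj a * z) = 1" by (metis eq_iff_diff_eq_0 norm_one)
    then have "norm a * norm z = 1" by (simp add: norm_mult)
    moreover have "norm a * norm z < 1 * 1" using a that by (intro mult_strict_mono') auto
    ultimately show False by simp
  qed
  define F where "F = (\<lambda>z. Moebius_function 0 a (G (k z)))"
  have "norm (F t) \<le> norm t"
  proof (rule Schwarz_Lemma(1)[OF _ _ _ t])
    have "Moebius_function 0 a \<circ> (G \<circ> k) holomorphic_on ball 0 1"
      by (intro holomorphic_on_compose_gen[OF _ Moebius_function_holomorphic[OF a]]
          holomorphic_on_compose_gen[OF holk holG]) (use k Gk in auto)
    then show "F holomorphic_on ball 0 1" by (simp add: F_def o_def)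
    show "F 0 = 0" by (simp add: F_def a_def Moebius_function_simple)
    show "norm (F z) < 1" if "norm z < 1" for z
      unfolding F_def using a Gk[OF that] by (rule Moebius_function_norm_lt_1)
  qed
  then have le: "norm (b - a) \<le> norm t * norm (1 - cnj a * b)"
    using nz[OF b] by (simp add: F_def Moebius_function_simple norm_divide b_def[symmetric] pos_divide_le_eq)
  show "bdry_ratio (G (k t)) \<le> bdry_ratio (G (k 0)) * bdry_ratio t"
    using bdry_ratio_le_mult[OF a b t le] by (simp add: a_def b_def)
  have "norm (1 - cnj b * a) = norm (1 - cnj a * b)"
    by (metis complex_cnj_cnj complex_cnj_diff complex_cnj_mult complex_cnj_one complex_mod_cnj mult.commute)
  then have "norm (a - b) \<le> norm t * norm (1 - cnj b * a)" using le by (simp add: norm_minus_commute)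
  from bdry_ratio_le_mult[OF b a t this]
  show "bdry_ratio (G (k 0)) \<le> bdry_ratio (G (k t)) * bdry_ratio t"
    by (simp add: a_def b_def)
qed

text \<open>The disc is mapped onto the strip by a multiple of \<open>Ln ((1 + z) / (1 - z))\<close>; in a strip of half-width
\<open>pi / (2 * s)\<close> the hyperbolic metric on the real axis is \<open>s\<close> times the Euclidean one.\<close>

lemma bdry_ratio_strip:
  fixes u v s :: real
  assumes holG: "G holomorphic_on S" and G: "G ` S \<subseteq> ball 0 1" and s: "0 < s"
    and strip: "\<And>z. \<bar>Im z\<bar> < pi / (2 * s) \<Longrightarrow> z \<in> S" and uv: "u \<le> v"
  shows "bdry_ratio (G (of_real v)) \<le> bdry_ratio (G (of_real u)) * exp (s * (v - u))"
proof -
  define e where "e = exp (s * (v - u))"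
  have e: "1 \<le> e" using s uv by (simp add: e_def)
  define t where "t = (e - 1) / (e + 1)"
  have t: "0 \<le> t" "t < 1" "(1 + t) / (1 - t) = e" using e by (auto simp: t_def field_simps)
  define k where "k = (\<lambda>z. of_real u + Ln ((1 + z) / (1 - z)) / of_real s)"
  have Re_pos: "0 < Re ((1 + z) / (1 - z))" if z: "norm z < 1" for z :: complex
  proof -
    have z1: "z \<noteq> 1" using z by auto
    have "(norm z)\<^sup>2 < 1" using z by (simp add: power_less_one_iff abs_square_less_1)
    then have "(Re z)\<^sup>2 + (Im z)\<^sup>2 < 1" by (simp add: cmod_power2)
    then have "0 < Re ((1 + z) * cnj (1 - z))"
      by (simp add: power2_eq_square algebra_simps)
    then show ?thesis using z1
      by (simp add: complex_div_cnj[of "1 + z"] Re_divide_of_real zero_less_divide_iff del: of_real_power flip: of_real_power)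
  qed
  have k: "k ` ball 0 1 \<subseteq> S"
  proof (clarify, rule strip)
    fix z :: complex assume "z \<in> ball 0 1"
    then have pos: "0 < Re ((1 + z) / (1 - z))" using Re_pos by simp
    then have "(1 + z) / (1 - z) \<noteq> 0" by force
    then have "\<bar>Im (Ln ((1 + z) / (1 - z)))\<bar> < pi / 2"
      using Re_Ln_pos_lt pos by blast
    then show "\<bar>Im (k z)\<bar> < pi / (2 * s)" using s by (simp add: k_def Im_divide_of_real field_simps)
  qed
  have "k holomorphic_on ball 0 1" unfolding k_def
  proof (intro holomorphic_intros)
    fix z :: complex assume "z \<in> ball 0 1"
    then have "0 < Re ((1 + z) / (1 - z))" using Re_pos by simp
    then show "(1 + z) / (1 - z) \<notin> \<real>\<^sub>\<le>\<^sub>0" using complex_nonpos_Reals_iff by fastforce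
  qed (use s in auto)
  from Schwarz_Pick_bdry_ratio(1)[OF holG G this k, of "of_real t"]
  have "bdry_ratio (G (k (of_real t))) \<le> bdry_ratio (G (k 0)) * bdry_ratio (of_real t)" using t by simp
  moreover have "k (of_real t) = of_real v"
  proof -
    have "(1 + of_real t) / (1 - of_real t) = (of_real ((1 + t) / (1 - t)) :: complex)" by simp
    then have "Ln ((1 + of_real t) / (1 - of_real t)) = of_real (s * (v - u))"
      using t(3) Ln_of_real[of e] by (simp add: e_def)
    then show ?thesis using s by (simp add: k_def)
  qed
  moreover have "k 0 = of_real u" by (simp add: k_def)
  moreover have "bdry_ratio (of_real t) = e" using t by (simp add: bdry_ratio_def)
  ultimately show ?thesis by (simp add: e_def)
qed

text \<open>The two points have distance 1 to the boundary of the disc, on opposite sides of its centre. Their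
hyperbolic distance is logarithmic in the radius.\<close>

lemma bdry_ratio_disc:
  fixes m R :: real
  assumes holG: "G holomorphic_on S" and G: "G ` S \<subseteq> ball 0 1"
    and disc: "ball (of_real m) R \<subseteq> S" and R: "1 \<le> R"
  shows "bdry_ratio (G (of_real (m + (R - 1)))) \<le> bdry_ratio (G (of_real (m - (R - 1)))) * (2 * R)\<^sup>2"
proof -
  define k where "k = (\<lambda>z::complex. of_real m + of_real R * z)"
  have k: "k ` ball 0 1 \<subseteq> S"
    using R by (intro order_trans[OF _ disc]) (auto simp: k_def dist_norm norm_mult)
  have holk: "k holomorphic_on ball 0 1" unfolding k_def by (intro holomorphic_intros)
  define t where "t = 1 - 1 / R"
  have t: "0 \<le> t" "t < 1" "(1 + t) / (1 - t) = 2 * R - 1" using R by (auto simp: t_def field_simps)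
  have "R * t = R - 1" using R by (simp add: t_def field_simps)
  then have kt: "k (of_real t) = of_real (m + (R - 1))" "k (- of_real t) = of_real (m - (R - 1))"
    by (simp_all add: k_def flip: of_real_mult of_real_add of_real_diff of_real_minus)
  have bt: "bdry_ratio (of_real t) = 2 * R - 1" "bdry_ratio (- of_real t) = 2 * R - 1"
    using t by (simp_all add: bdry_ratio_def)
  have pos: "0 \<le> bdry_ratio (G (k z))" if "norm z < 1" for z
    using that k G by (force simp: bdry_ratio_def image_subset_iff intro!: divide_nonneg_nonneg)
  have "bdry_ratio (G (k (of_real t))) \<le> bdry_ratio (G (k 0)) * (2 * R - 1)"
    using Schwarz_Pick_bdry_ratio(1)[OF holG G holk k, of "of_real t"] t bt by simp
  also have "\<dots> \<le> (bdry_ratio (G (k (- of_real t))) * (2 * R - 1)) * (2 * R - 1)"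
    using Schwarz_Pick_bdry_ratio(2)[OF holG G holk k, of "- of_real t"] t bt R
    by (intro mult_right_mono) auto
  also have "\<dots> = bdry_ratio (G (k (- of_real t))) * (2 * R - 1)\<^sup>2" by (simp add: power2_eq_square)
  also have "\<dots> \<le> bdry_ratio (G (k (- of_real t))) * (2 * R)\<^sup>2"
    using R t by (intro mult_left_mono power_mono pos) auto
  finally show ?thesis by (simp add: kt)
qed

text \<open>Along the real axis from \<open>n^2\<close> to \<open>(n + 1)^2\<close>: the strip is used on the block and within distance 1 of
the ends of the gap, the disc that fills the gap on the rest. The gap thus costs only a
polynomial factor, while the block costs \<open>exp (2 * p * n)\<close>, the product of its length and
\<open>p + 1\<close> being \<open>2 * p * n\<close>.\<close>

lemma bdry_ratio_comb_step:
  assumes p: "0 < p" and holG: "G holomorphic_on comb p" and G: "G ` comb p \<subseteq> ball 0 1"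
    and n: "p + 1 \<le> real n"
  shows "bdry_ratio (G (of_real ((real (Suc n))\<^sup>2)))
      \<le> bdry_ratio (G (of_real ((real n)\<^sup>2))) * (exp (2 * p * real n + 2 * (p + 1)) * (2 * real n + 1)\<^sup>2)"
proof -
  define a b where "a = (real n)\<^sup>2 + 2 * p / (p + 1) * real n" and "b = (real (Suc n))\<^sup>2"
  define R where "R = (b - a) / 2"
  have ba: "b - a = 1 + 2 * real n / (p + 1)"
    using p by (simp add: a_def b_def field_simps power2_eq_square)
  have "2 \<le> 2 * real n / (p + 1)" using n p by (simp add: field_simps)
  then have R: "1 \<le> R" using ba by (simp add: R_def)
  have R2: "2 * R \<le> 2 * real n + 1" using p by (simp add: R_def a_def b_def power2_eq_square algebra_simps)
  define B where "B = (\<lambda>x::real. bdry_ratio (G (of_real x)))"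
  have strip: "B v \<le> B u * exp ((p + 1) * (v - u))" if "u \<le> v" for u v
    unfolding B_def by (rule bdry_ratio_strip[OF holG G _ _ that]) (use p in \<open>auto intro: strip_subset_comb\<close>)
  have real_in: "of_real x \<in> comb p" for x using p by (intro strip_subset_comb) simp
  have B0: "0 \<le> B x" for x
    using real_in[of x] G by (force simp: B_def bdry_ratio_def image_subset_iff intro!: divide_nonneg_nonneg)
  have "B b \<le> B (b - 1) * exp ((p + 1) * (b - (b - 1)))" by (rule strip) simp
  also have "\<dots> \<le> (B (a + 1) * (2 * R)\<^sup>2) * exp (p + 1)"
  proof -
    have "(a + b) / 2 + (R - 1) = b - 1" "(a + b) / 2 - (R - 1) = a + 1" by (auto simp: R_def field_simps)
    with bdry_ratio_disc[OF holG G ball_in_gap_subset_comb[OF p a_def b_def, folded R_def] R]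
    have "B (b - 1) \<le> B (a + 1) * (2 * R)\<^sup>2" by (simp only: B_def)
    then show ?thesis by (simp add: mult_right_mono)
  qed
  also have "\<dots> \<le> ((B ((real n)\<^sup>2) * exp (2 * p * real n + (p + 1))) * (2 * real n + 1)\<^sup>2) * exp (p + 1)"
  proof (intro mult_right_mono mult_mono)
    have "0 \<le> 2 * p / (p + 1) * real n" using p by simp
    then have "B (a + 1) \<le> B ((real n)\<^sup>2) * exp ((p + 1) * (a + 1 - (real n)\<^sup>2))"
      by (intro strip) (simp add: a_def)
    also have "(p + 1) * (a + 1 - (real n)\<^sup>2) = 2 * p * real n + (p + 1)"
      using p by (simp add: a_def field_simps)
    finally show "B (a + 1) \<le> B ((real n)\<^sup>2) * exp (2 * p * real n + (p + 1))" .
    show "(2 * R)\<^sup>2 \<le> (2 * real n + 1)\<^sup>2" using R R2 by (intro power_mono) auto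
  qed (use B0 in auto)
  also have "\<dots> = B ((real n)\<^sup>2) * (exp (2 * p * real n + 2 * (p + 1)) * (2 * real n + 1)\<^sup>2)"
  proof -
    have "2 * p * real n + 2 * (p + 1) = (2 * p * real n + (p + 1)) + (p + 1)" by simp
    then have "exp (2 * p * real n + 2 * (p + 1)) = exp (2 * p * real n + (p + 1)) * exp (p + 1)"
      by (simp only: exp_add)
    then show ?thesis by (simp only: mult_ac)
  qed
  finally show ?thesis by (simp add: B_def b_def)
qed

text \<open>At the points \<open>G (n^2)\<close> the function \<open>exp \<circ> g\<close> has the value \<open>exp (n^2)\<close>, whereas their inverse
distance to the circle is at most of the order \<open>exp (p * n^2 + O(n * ln n))\<close>. For \<open>q > p\<close> this
contradicts the growth bound for functions in the Hardy space.\<close>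

lemma exp_comb_map_not_in_hardy_space:
  assumes p: "0 < p" and q: "p < q"
    and holg: "g holomorphic_on ball 0 1"
    and holG: "G holomorphic_on comb p" and G: "G ` comb p \<subseteq> ball 0 1"
    and gG: "\<And>z. z \<in> comb p \<Longrightarrow> g (G z) = z"
  shows "(\<lambda>z. exp (g z)) \<notin> hardy_space q"
proof
  assume mem: "(\<lambda>z. exp (g z)) \<in> hardy_space q"
  have "0 < q" using p q by simp
  obtain C where C: "\<And>z. z \<in> ball 0 1 \<Longrightarrow> exp (q * Re (g z)) * (1 - norm z) \<le> C"
    using hardy_space_growth[OF holg \<open>0 < q\<close> mem] by blast
  define E where "E = (\<lambda>n::nat. bdry_ratio (G (of_real ((real n)\<^sup>2))))"
  have real_in: "of_real x \<in> comb p" for x using p by (intro strip_subset_comb) simp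
  have nG: "norm (G (of_real x)) < 1" for x using real_in[of x] G by (force simp: image_subset_iff)
  have E: "1 / (1 - norm (G (of_real ((real n)\<^sup>2)))) \<le> E n" "0 < E n" for n
  proof -
    define a where "a = norm (G (of_real ((real n)\<^sup>2)))"
    have a: "0 \<le> a" "a < 1" using nG[of "(real n)\<^sup>2"] unfolding a_def by auto
    have En: "E n = (1 + a) / (1 - a)" by (simp add: E_def bdry_ratio_def a_def)
    show "1 / (1 - norm (G (of_real ((real n)\<^sup>2)))) \<le> E n"
      unfolding En a_def[symmetric] using a by (intro divide_right_mono) auto
    show "0 < E n" unfolding En using a by simp
  qed
  define \<rho> where "\<rho> = (\<lambda>n. exp (q * (real n)\<^sup>2) / E n)"
  have \<rho>C: "\<rho> n \<le> C" for n
  proof -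
    define z where "z = G (of_real ((real n)\<^sup>2))"
    define d where "d = 1 - norm z"
    have z: "norm z < 1" unfolding z_def by (rule nG)
    have d: "0 < d" using z by (simp add: d_def)
    have "g z = of_real ((real n)\<^sup>2)" unfolding z_def by (rule gG[OF real_in])
    then have "Re (g z) = (real n)\<^sup>2" by (simp only: Re_complex_of_real)
    then have "exp (q * (real n)\<^sup>2) * d \<le> C"
      using C[of z] z by (simp add: d_def)
    moreover have "\<rho> n \<le> exp (q * (real n)\<^sup>2) * d"
    proof -
      have "1 / d \<le> E n" using E(1)[of n] unfolding d_def z_def .
      then have "1 \<le> d * E n" using d by (simp add: field_simps)
      then have "exp (q * (real n)\<^sup>2) * 1 \<le> exp (q * (real n)\<^sup>2) * (d * E n)" by (intro mult_left_mono) auto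
      then show ?thesis using E(2)[of n] by (simp add: \<rho>_def divide_le_eq mult_ac)
    qed
    ultimately show ?thesis by simp
  qed
  have "eventually (\<lambda>n::nat. 2 * (exp (2 * p * real n + 2 * (p + 1)) * (2 * real n + 1)\<^sup>2) \<le> exp (q * (2 * real n + 1))) sequentially"
    using p q by real_asymp
  then obtain N0 where N0: "\<And>n. N0 \<le> n \<Longrightarrow>
      2 * (exp (2 * p * real n + 2 * (p + 1)) * (2 * real n + 1)\<^sup>2) \<le> exp (q * (2 * real n + 1))"
    unfolding eventually_sequentially by blast
  obtain N1 :: nat where N1: "p + 1 \<le> real N1" using real_arch_simple by blast
  define N where "N = max N0 N1"
  have step: "2 * \<rho> n \<le> \<rho> (Suc n)" if n: "N \<le> n" for n
  proof -
    define K where "K = exp (2 * p * real n + 2 * (p + 1)) * (2 * real n + 1)\<^sup>2"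
    have "p + 1 \<le> real n" using N1 n by (simp add: N_def)
    then have EK: "E (Suc n) \<le> E n * K"
      using bdry_ratio_comb_step[OF p holG G, of n] by (simp add: E_def K_def)
    have "2 * K \<le> exp (q * (2 * real n + 1))" using N0[of n] n by (simp add: K_def N_def)
    then have "2 * exp (q * (real n)\<^sup>2) * K \<le> exp (q * (real n)\<^sup>2) * exp (q * (2 * real n + 1))"
      using mult_left_mono[of "2 * K" "exp (q * (2 * real n + 1))" "exp (q * (real n)\<^sup>2)"]
      by (simp only: mult_ac exp_ge_zero)
    also have "\<dots> = exp (q * (real n)\<^sup>2 + q * (2 * real n + 1))" by (simp only: exp_add)
    also have "q * (real n)\<^sup>2 + q * (2 * real n + 1) = q * (real (Suc n))\<^sup>2"
      by (simp add: power2_eq_square algebra_simps)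
    finally have le: "2 * exp (q * (real n)\<^sup>2) * K \<le> exp (q * (real (Suc n))\<^sup>2)" .
    have K: "0 < K" by (simp add: K_def add_nonneg_pos)
    have "2 * \<rho> n = 2 * exp (q * (real n)\<^sup>2) * K / (E n * K)" using K by (simp add: \<rho>_def)
    also have "\<dots> \<le> exp (q * (real (Suc n))\<^sup>2) / E (Suc n)"
      using le EK E(2) K by (intro frac_le) auto
    finally show ?thesis by (simp add: \<rho>_def)
  qed
  have grow: "\<rho> N * 2 ^ j \<le> \<rho> (N + j)" for j
  proof (induction j)
    case (Suc j)
    then show ?case using step[of "N + j"] by simp
  qed simp
  have "\<rho> N > 0" using E(2) by (simp add: \<rho>_def)
  obtain j where "C / \<rho> N < 2 ^ j" using real_arch_pow[of 2 "C / \<rho> N"] by auto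
  then have "C < \<rho> N * 2 ^ j" using \<open>\<rho> N > 0\<close> by (simp add: field_simps)
  then show False using grow[of j] \<rho>C[of "N + j"] by simp
qed


theorem theorem5p2:
  fixes p :: real
  assumes "0 < p"
  shows "\<exists>\<Omega>. is_domain \<Omega> \<and> domain_hardy_number \<Omega> = ereal p"
proof (intro exI conjI)
  have sc: "simply_connected (comb p)"
    using contractible_comb[OF assms] by (rule contractible_imp_simply_connected)
  have ne: "comb p \<noteq> {}" using strip_subset_comb[of 0 p] assms by auto
  show "is_domain (exp ` comb p)" unfolding is_domain_def
  proof (intro conjI)
    show "exp ` comb p \<noteq> {}" using ne by simp
    show "open (exp ` comb p)"
    proof (rule open_mapping_thm[of _ UNIV])
      show "(exp :: complex \<Rightarrow> complex) holomorphic_on UNIV" by (intro holomorphic_intros)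
      show "\<not> (exp :: complex \<Rightarrow> complex) constant_on UNIV"
      proof
        assume "(exp :: complex \<Rightarrow> complex) constant_on UNIV"
        then obtain c where "\<And>z :: complex. exp z = c" unfolding constant_on_def by blast
        from this[of 0] this[of "\<i> * pi"] show False by simp
      qed
    qed (auto simp: open_comb)
    show "connected (exp ` comb p)"
      by (intro connected_continuous_image continuous_intros simply_connected_imp_connected sc)
  qed
  show "domain_hardy_number (exp ` comb p) = ereal p"
  proof (rule antisym)
    obtain G g where holG: "G holomorphic_on comb p" and holg: "g holomorphic_on ball 0 1"
      and G: "\<forall>z\<in>comb p. G z \<in> ball 0 1 \<and> g (G z) = z"
      and g: "\<forall>z\<in>ball 0 1. g z \<in> comb p \<and> G (g z) = z"
    proof -
      have "open (comb p) \<and> simply_connected (comb p)" using open_comb sc by blast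
      then show ?thesis
        unfolding Riemann_mapping_theorem using ne comb_neq_UNIV[OF assms] that by blast
    qed
    have "domain_hardy_number (exp ` comb p) \<le> hardy_number (\<lambda>z. exp (g z))"
      unfolding domain_hardy_number_def
    proof (rule Inf_lower, intro CollectI exI conjI, rule refl)
      show "(\<lambda>z. exp (g z)) holomorphic_on ball 0 1" using holg by (intro holomorphic_intros)
    qed (use g in auto)
    also have "\<dots> \<le> ereal p" unfolding hardy_number_def
    proof (rule Sup_least)
      fix x assume "x \<in> {0} \<union> {ereal q |q. 0 < q \<and> (\<lambda>z. exp (g z)) \<in> hardy_space q}"
      moreover have "(\<lambda>z. exp (g z)) \<notin> hardy_space q" if "p < q" for q
        using G by (intro exp_comb_map_not_in_hardy_space[OF assms that holg holG]) auto
      ultimately show "x \<le> ereal p" using assms by (auto intro!: leI)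
    qed
    finally show "domain_hardy_number (exp ` comb p) \<le> ereal p" .
    show "ereal p \<le> domain_hardy_number (exp ` comb p)" unfolding domain_hardy_number_def
    proof (rule Inf_greatest, clarify)
      fix f assume f: "f holomorphic_on ball 0 1" "f ` ball 0 1 \<subseteq> exp ` comb p"
      have le: "ereal q \<le> hardy_number f" if q: "0 < q" "q < p" for q
      proof -
        obtain U where "continuous_on (exp ` comb p) U"
          "\<And>w. w \<in> exp ` comb p \<Longrightarrow> harmonic_above U w"
          "\<And>w. w \<in> exp ` comb p \<Longrightarrow> cmod w powr q \<le> U w"
          using superharmonic_majorant_exp_comb[OF q] by blast
        then have "f \<in> hardy_space q" by (rule hardy_space_superharmonic_majorant[OF f(1) q(1) f(2)])
        then show ?thesis unfolding hardy_number_def using q by (intro Sup_upper) auto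
      qed
      show "ereal p \<le> hardy_number f"
      proof (rule ccontr)
        assume "\<not> ereal p \<le> hardy_number f"
        moreover have "0 \<le> hardy_number f" unfolding hardy_number_def by (intro Sup_upper) simp
        ultimately obtain h where h: "hardy_number f = ereal h" "0 \<le> h" "h < p"
          by (cases "hardy_number f") auto
        then show False using le[of "(h + p) / 2"] by simp
      qed
    qed
  qed
qed

end
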